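(* Let $N\ge 2$, let $\Omega\subset\mathbb{C}^N$ be any bounded open set with boundary $\partial\Omega$, and let $x_0\in\Omega$. Then there exists a compact set $X\subset\partial\Omega$ such that $x_0$ is in $\widehat X\setminus X$ and is a one-point Gleason part for $P(X)$, and $P(X)$ has dense invertibles.
   Context: For a compact set $X\subset\mathbb{C}^N$, the polynomial hull of $X$ is $\widehat X=\{z\in\mathbb{C}^N: |p(z)|\le \max_{x\in X}|p(x)| \text{ for all polynomials } p\}$, where polynomials are holomorphic polynomials in the complex coordinates $z_1,\ldots,z_N$. $P(X)$ denotes the closure, in the algebra $C(X)$ of continuous complex-valued functions on $X$ with the supremum norm, of (the restrictions to $X$ of) the polynomials in $z_1,\ldots,z_N$. $P(X)$ has dense invertibles if the set of invertible elements of the algebra $P(X)$ is dense in $P(X)$. The maximal ideal space of $P(X)$ is identified with $\widehat X$: a point $z\in\widehat X$ corresponds to the unique continuous multiplicative linear functional $\varphi_z$ on $P(X)$ with $\varphi_z(p)=p(z)$ for every polynomial $p$. The Gleason parts for $P(X)$ are the equivalence classes in $\widehat X$ under the relation $z\sim w$ iff $\|\varphi_z-\varphi_w\|<2$ in the norm of the dual space $P(X)^*$ (this is an equivalence relation). A point $x_0\in\widehat X$ is a one-point Gleason part for $P(X)$ if $\{x_0\}$ is a Gleason part, i.e., $\|\varphi_{x_0}-\varphi_w\|=2$ for every $w\in\widehat X\setminus\{x_0\}$. *)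

theory Defs
  imports "HOL-Analysis.Analysis"
begin

definition polynomial_map :: "(complex ^ 'n \<Rightarrow> complex) \<Rightarrow> bool" where
  "polynomial_map p \<longleftrightarrow>
     (\<exists>(S :: ('n \<Rightarrow> nat) set) c. finite S \<and>
        p = (\<lambda>z. \<Sum>\<alpha>\<in>S. c \<alpha> * (\<Prod>i\<in>UNIV. (z $ i) ^ \<alpha> i)))"

definition sup_norm :: "'a set \<Rightarrow> ('a \<Rightarrow> complex) \<Rightarrow> real" where
  "sup_norm X f = (SUP x\<in>X. norm (f x))"

definition poly_hull :: "(complex ^ 'n) set \<Rightarrow> (complex ^ 'n) set" where
  "poly_hull X = {z. \<forall>p. polynomial_map p \<longrightarrow> norm (p z) \<le> sup_norm X p}"

text \<open>For compact X the elements of C(X), and so of its subalgebra P(X), are represented by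
  functions that are \<^const>\<open>undefined\<close> outside X, so that equality in the algebra is
  equality in HOL. Only the values on X enter \<^const>\<open>sup_norm\<close>.\<close>

definition C_alg :: "'a::topological_space set \<Rightarrow> ('a \<Rightarrow> complex) set" where
  "C_alg X = {f \<in> extensional X. continuous_on X f}"

definition P_alg :: "(complex ^ 'n) set \<Rightarrow> (complex ^ 'n \<Rightarrow> complex) set" where
  "P_alg X = {f \<in> C_alg X. \<forall>e>0. \<exists>p. polynomial_map p \<and> sup_norm X (\<lambda>x. f x - p x) < e}"

definition P_units :: "(complex ^ 'n) set \<Rightarrow> (complex ^ 'n \<Rightarrow> complex) set" where
  "P_units X = {f \<in> P_alg X. \<exists>g\<in>P_alg X. \<forall>x\<in>X. f x * g x = 1}"

definition dense_invertibles :: "(complex ^ 'n) set \<Rightarrow> bool" where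
  "dense_invertibles X \<longleftrightarrow>
     (\<forall>f\<in>P_alg X. \<forall>e>0. \<exists>g\<in>P_units X. sup_norm X (\<lambda>x. f x - g x) < e)"

text \<open>Functionals are \<^const>\<open>undefined\<close> outside P(X), so that a functional is
  determined by its values on P(X).\<close>

definition mult_functional ::
    "(complex ^ 'n) set \<Rightarrow> ((complex ^ 'n \<Rightarrow> complex) \<Rightarrow> complex) \<Rightarrow> bool" where
  "mult_functional X \<phi> \<longleftrightarrow>
     \<phi> \<in> extensional (P_alg X) \<and>
     (\<forall>f\<in>P_alg X. \<forall>g\<in>P_alg X. \<phi> (\<lambda>x\<in>X. f x + g x) = \<phi> f + \<phi> g) \<and>
     (\<forall>c. \<forall>f\<in>P_alg X. \<phi> (\<lambda>x\<in>X. c * f x) = c * \<phi> f) \<and>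
     (\<forall>f\<in>P_alg X. \<forall>g\<in>P_alg X. \<phi> (\<lambda>x\<in>X. f x * g x) = \<phi> f * \<phi> g) \<and>
     (\<forall>f\<in>P_alg X. \<forall>e>0. \<exists>d>0. \<forall>g\<in>P_alg X.
        sup_norm X (\<lambda>x. g x - f x) < d \<longrightarrow> norm (\<phi> g - \<phi> f) < e)"

text \<open>For compact X, each point of the hull determines exactly one such functional; this makes
  the definite description that defines the point functional meaningful.\<close>

lemma polynomial_map_indexed:
  assumes "finite I"
  shows "polynomial_map (\<lambda>z. \<Sum>j\<in>I. d j * (\<Prod>i\<in>UNIV. (z $ i) ^ e j i))"
proof -
  have "(\<Sum>j\<in>I. d j * (\<Prod>i\<in>UNIV. (z $ i) ^ e j i)) =
     (\<Sum>a\<in>e ` I. (\<Sum>j\<in>{j\<in>I. e j = a}. d j) * (\<Prod>i\<in>UNIV. (z $ i) ^ a i))" for z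
  proof -
    have "(\<Sum>j\<in>I. d j * (\<Prod>i\<in>UNIV. (z $ i) ^ e j i)) =
      (\<Sum>a\<in>e ` I. \<Sum>j\<in>{j\<in>I. e j = a}. d j * (\<Prod>i\<in>UNIV. (z $ i) ^ e j i))"
      by (rule sum.image_gen[OF assms])
    also have "\<dots> = (\<Sum>a\<in>e ` I. (\<Sum>j\<in>{j\<in>I. e j = a}. d j) * (\<Prod>i\<in>UNIV. (z $ i) ^ a i))"
      by (intro sum.cong refl) (simp add: sum_distrib_right)
    finally show ?thesis .
  qed
  then show ?thesis
    unfolding polynomial_map_def using assms
    by (intro exI[of _ "e ` I"] exI[of _ "\<lambda>a. \<Sum>j\<in>{j\<in>I. e j = a}. d j"]) simp
qed

lemma polynomial_map_const: "polynomial_map (\<lambda>z. c)"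
  using polynomial_map_indexed[of "{()}" "\<lambda>_. c" "\<lambda>_ _. 0"] by simp

lemma polynomial_map_coord:
  fixes k :: "'n::finite"
  shows "polynomial_map (\<lambda>z :: complex ^ 'n. z $ k)"
proof -
  have "(\<Prod>i\<in>UNIV. (z $ i) ^ (if i = k then 1 else 0)) = z $ k" for z :: "complex ^ 'n"
    by (subst prod.remove[of _ k]) (auto intro!: prod.neutral)
  then show ?thesis
    using polynomial_map_indexed[of "{()}" "\<lambda>_. 1" "\<lambda>_ i. if i = k then 1 else 0"] by simp
qed

lemma polynomial_map_add:
  assumes "polynomial_map p" "polynomial_map q"
  shows "polynomial_map (\<lambda>z. p z + q z)"
proof -
  obtain S c where S: "finite S" "p = (\<lambda>z. \<Sum>\<alpha>\<in>S. c \<alpha> * (\<Prod>i\<in>UNIV. (z $ i) ^ \<alpha> i))"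
    using assms(1) unfolding polynomial_map_def by blast
  obtain T d where T: "finite T" "q = (\<lambda>z. \<Sum>\<alpha>\<in>T. d \<alpha> * (\<Prod>i\<in>UNIV. (z $ i) ^ \<alpha> i))"
    using assms(2) unfolding polynomial_map_def by blast
  have "polynomial_map (\<lambda>z. \<Sum>j\<in>S <+> T. case_sum c d j * (\<Prod>i\<in>UNIV. (z $ i) ^ case_sum id id j i))"
    using S T by (intro polynomial_map_indexed) auto
  then show ?thesis using S T by (simp add: sum.Plus)
qed

lemma polynomial_map_mult:
  assumes "polynomial_map p" "polynomial_map q"
  shows "polynomial_map (\<lambda>z. p z * q z)"
proof -
  obtain S c where S: "finite S" "p = (\<lambda>z. \<Sum>\<alpha>\<in>S. c \<alpha> * (\<Prod>i\<in>UNIV. (z $ i) ^ \<alpha> i))"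
    using assms(1) unfolding polynomial_map_def by blast
  obtain T d where T: "finite T" "q = (\<lambda>z. \<Sum>\<alpha>\<in>T. d \<alpha> * (\<Prod>i\<in>UNIV. (z $ i) ^ \<alpha> i))"
    using assms(2) unfolding polynomial_map_def by blast
  have "polynomial_map (\<lambda>z. \<Sum>j\<in>S \<times> T. (c (fst j) * d (snd j)) *
          (\<Prod>i\<in>UNIV. (z $ i) ^ (fst j i + snd j i)))"
    using S T by (intro polynomial_map_indexed) auto
  also have "(\<lambda>z. \<Sum>j\<in>S \<times> T. (c (fst j) * d (snd j)) *
          (\<Prod>i\<in>UNIV. (z $ i) ^ (fst j i + snd j i))) = (\<lambda>z. p z * q z)"
    unfolding S(2) T(2) sum_product sum.cartesian_product
    by (intro ext sum.cong refl) (auto simp: power_add prod.distrib mult_ac)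
  finally show ?thesis .
qed

lemma polynomial_map_diff:
  assumes "polynomial_map p" "polynomial_map q"
  shows "polynomial_map (\<lambda>z. p z - q z)"
  using polynomial_map_add[OF assms(1) polynomial_map_mult[OF polynomial_map_const[of "-1"] assms(2)]]
  by simp

lemma polynomial_map_continuous: "polynomial_map p \<Longrightarrow> continuous_on X p"
  unfolding polynomial_map_def by (auto intro!: continuous_intros)

lemma norm_le_sup_norm:
  assumes "compact X" "continuous_on X f" "x \<in> X"
  shows "norm (f x) \<le> sup_norm X f"
  unfolding sup_norm_def
  by (intro cSUP_upper assms bounded_imp_bdd_above compact_imp_bounded compact_continuous_image)
     (auto intro!: continuous_intros assms)

lemma sup_norm_le:
  assumes "X \<noteq> {}" "\<And>x. x \<in> X \<Longrightarrow> norm (f x) \<le> B"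
  shows "sup_norm X f \<le> B"
  unfolding sup_norm_def using assms by (intro cSUP_least) auto

lemma poly_hull_nonempty:
  assumes "z \<in> poly_hull X" shows "X \<noteq> {}"
proof
  assume [simp]: "X = {}"
  have "norm (of_real (\<bar>Sup {}\<bar> + 1) :: complex) \<le> sup_norm X (\<lambda>_. of_real (\<bar>Sup {}\<bar> + 1) :: complex)"
    using assms polynomial_map_const unfolding poly_hull_def by blast
  then show False
    unfolding sup_norm_def norm_of_real by simp
qed

lemma P_alg_iff:
  assumes "compact X" "X \<noteq> {}"
  shows "f \<in> P_alg X \<longleftrightarrow> f \<in> extensional X \<and>
           (\<exists>p. (\<forall>n. polynomial_map (p n)) \<and> uniform_limit X p f sequentially)"
proof (intro iffI conjI; (elim conjE exE)?)
  assume f: "f \<in> P_alg X"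
  then show "f \<in> extensional X" by (simp add: P_alg_def C_alg_def)
  have cont: "continuous_on X f" using f by (simp add: P_alg_def C_alg_def)
  have "\<forall>n. \<exists>p. polynomial_map p \<and> sup_norm X (\<lambda>x. f x - p x) < 1 / real (Suc n)"
    using f by (simp add: P_alg_def)
  then obtain p where p: "\<And>n. polynomial_map (p n)"
      "\<And>n. sup_norm X (\<lambda>x. f x - p n x) < 1 / real (Suc n)" by metis
  have "uniform_limit X p f sequentially"
  proof (rule uniform_limitI)
    fix e :: real assume "e > 0"
    then have "\<forall>\<^sub>F n in sequentially. 1 / real (Suc n) < e"
      using order_tendstoD(2)[OF LIMSEQ_inverse_real_of_nat] by (simp add: inverse_eq_divide)
    then show "\<forall>\<^sub>F n in sequentially. \<forall>x\<in>X. dist (p n x) (f x) < e"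
    proof eventually_elim
      case (elim n)
      have "norm (f x - p n x) \<le> sup_norm X (\<lambda>x. f x - p n x)" if "x \<in> X" for x
        by (rule norm_le_sup_norm[OF assms(1)])
           (use cont polynomial_map_continuous[OF p(1)] that in \<open>auto intro!: continuous_intros\<close>)
      then show ?case using p(2)[of n] elim
        by (force simp: dist_norm norm_minus_commute)
    qed
  qed
  then show "\<exists>p. (\<forall>n. polynomial_map (p n)) \<and> uniform_limit X p f sequentially"
    using p by blast
next
  fix p assume f: "f \<in> extensional X" and p: "\<forall>n. polynomial_map (p n)"
    and lim: "uniform_limit X p f sequentially"
  have "continuous_on X f"
    by (rule uniform_limit_theorem[OF _ lim]) (auto intro!: always_eventually polynomial_map_continuous p[rule_format])
  moreover have "\<exists>q. polynomial_map q \<and> sup_norm X (\<lambda>x. f x - q x) < e" if "e > 0" for e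
  proof -
    have "\<forall>\<^sub>F n in sequentially. \<forall>x\<in>X. dist (p n x) (f x) < e / 2"
      using uniform_limitD[OF lim, of "e/2"] that by simp
    then obtain n where "\<forall>x\<in>X. dist (p n x) (f x) < e / 2"
      using eventually_happens'[OF sequentially_bot] by blast
    then have "sup_norm X (\<lambda>x. f x - p n x) \<le> e / 2"
      by (intro sup_norm_le assms) (force simp: dist_norm norm_minus_commute)
    then show ?thesis using p that by (intro exI[of _ "p n"]) auto
  qed
  ultimately show "f \<in> P_alg X" using f by (simp add: P_alg_def C_alg_def)
qed

lemma point_functional_ex1:
  assumes X: "compact X" and z: "z \<in> poly_hull X"
  shows "\<exists>!\<phi>. mult_functional X \<phi> \<and> (\<forall>p. polynomial_map p \<longrightarrow> \<phi> (restrict p X) = p z)"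
proof -
  have ne: "X \<noteq> {}" using poly_hull_nonempty[OF z] .
  define A where "A f p \<longleftrightarrow> (\<forall>n. polynomial_map (p n)) \<and> uniform_limit X p f sequentially" for f p
  have P_iff: "f \<in> P_alg X \<longleftrightarrow> f \<in> extensional X \<and> (\<exists>p. A f p)" for f
    using P_alg_iff[OF X ne] by (simp add: A_def)
  have hull: "norm (p z) \<le> B" if "polynomial_map p" "\<And>x. x \<in> X \<Longrightarrow> norm (p x) \<le> B" for p B
    using z that sup_norm_le[OF ne that(2)] unfolding poly_hull_def by force
  have A_cong: "A f p \<longleftrightarrow> A g p" if "\<And>x. x \<in> X \<Longrightarrow> f x = g x" for f g p
    unfolding A_def uniform_limit_iff using that by simp
  have A_const: "A p (\<lambda>_. p)" if "polynomial_map p" for p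
    using that by (simp add: A_def uniform_limit_const)
  have bdd: "bounded (f ` X)" if "A f p" for f p
  proof -
    have "continuous_on X f"
      by (rule uniform_limit_theorem[where f = p and F = sequentially])
         (use that in \<open>auto simp: A_def intro!: always_eventually polynomial_map_continuous\<close>)
    then show ?thesis using X compact_continuous_image compact_imp_bounded by blast
  qed
  have A_add: "A (\<lambda>x. f x + g x) (\<lambda>n x. p n x + q n x)" if "A f p" "A g q" for f g p q
    using that by (auto simp: A_def intro!: polynomial_map_add uniform_limit_intros)
  have A_diff: "A (\<lambda>x. f x - g x) (\<lambda>n x. p n x - q n x)" if "A f p" "A g q" for f g p q
    using that by (auto simp: A_def intro!: polynomial_map_diff uniform_limit_intros)
  have A_mult: "A (\<lambda>x. f x * g x) (\<lambda>n x. p n x * q n x)" if "A f p" "A g q" for f g p q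
    using that bdd[OF that(1)] bdd[OF that(2)]
    by (auto simp: A_def intro!: polynomial_map_mult uniform_lim_mult)
  have bnd: "\<forall>\<^sub>F n in sequentially. norm (p n z) < B + e"
    if "A f p" "\<And>x. x \<in> X \<Longrightarrow> norm (f x) \<le> B" "e > 0" for f p B e
  proof -
    have "\<forall>\<^sub>F n in sequentially. \<forall>x\<in>X. dist (p n x) (f x) < e/2"
      using uniform_limitD[where S = X and f = p and l = f and F = sequentially and e = "e/2"] that by (auto simp: A_def)
    then show ?thesis
    proof eventually_elim
      case (elim n)
      have "norm (p n z) \<le> B + e/2"
      proof (rule hull)
        fix x assume "x \<in> X"
        then show "norm (p n x) \<le> B + e/2"
          using elim that(2)[of x] norm_triangle_ineq2[of "p n x" "f x"] by (fastforce simp: dist_norm)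
      qed (use that in \<open>auto simp: A_def\<close>)
      then show ?case using that by simp
    qed
  qed
  have conv: "convergent (\<lambda>n. p n z)" if "A f p" for f p
  proof -
    have "Cauchy (\<lambda>n. p n z)"
    proof (rule metric_CauchyI)
      fix e :: real assume "e > 0"
      then have "\<forall>\<^sub>F n in sequentially. \<forall>x\<in>X. dist (p n x) (f x) < e/4"
        using uniform_limitD[where S = X and f = p and l = f and F = sequentially and e = "e/4"] that by (auto simp: A_def)
      then obtain M where M: "\<And>n x. n \<ge> M \<Longrightarrow> x \<in> X \<Longrightarrow> dist (p n x) (f x) < e/4"
        unfolding eventually_sequentially by blast
      have "dist (p m z) (p n z) < e" if "m \<ge> M" "n \<ge> M" for m n
      proof -
        have "norm (p m z - p n z) \<le> e / 2"
        proof (rule hull)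
          show "polynomial_map (\<lambda>z. p m z - p n z)"
            using \<open>A f p\<close> by (auto simp: A_def intro!: polynomial_map_diff)
          fix x assume "x \<in> X"
          then have "dist (p m x) (p n x) < e / 2"
            using M[of m x] M[of n x] that dist_triangle_half_l[of "p m x" "f x" "e/2" "p n x"] by simp
          then show "norm (p m x - p n x) \<le> e / 2" by (simp add: dist_norm)
        qed
        then show ?thesis using \<open>e > 0\<close> by (simp add: dist_norm)
      qed
      then show "\<exists>M. \<forall>m\<ge>M. \<forall>n\<ge>M. dist (p m z) (p n z) < e" by blast
    qed
    then show ?thesis by (simp add: Cauchy_convergent_iff)
  qed
  have zero: "(\<lambda>n. p n z) \<longlonglongrightarrow> 0" if "A f p" "\<And>x. x \<in> X \<Longrightarrow> f x = 0" for f p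
    unfolding tendsto_iff using bnd[OF that(1), of 0] that(2) by simp
  define \<psi> where "\<psi> f = (SOME v. \<exists>p. A f p \<and> (\<lambda>n. p n z) \<longlonglongrightarrow> v)" for f
  have \<psi>: "(\<lambda>n. p n z) \<longlonglongrightarrow> \<psi> f" if "A f p" for f p
  proof -
    have "\<exists>v q. A f q \<and> (\<lambda>n. q n z) \<longlonglongrightarrow> v"
      using conv[OF that] that unfolding convergent_def by blast
    then have "\<exists>q. A f q \<and> (\<lambda>n. q n z) \<longlonglongrightarrow> \<psi> f" unfolding \<psi>_def by (rule someI_ex)
    then obtain q where q: "A f q" "(\<lambda>n. q n z) \<longlonglongrightarrow> \<psi> f" by blast
    have "(\<lambda>n. p n z - q n z) \<longlonglongrightarrow> 0" using zero[OF A_diff[OF that q(1)]] by simp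
    from tendsto_add[OF this q(2)] show ?thesis by simp
  qed
  have \<psi>_eq: "\<psi> f = v" if "A f p" "(\<lambda>n. p n z) \<longlonglongrightarrow> v" for f p v
    using \<psi>[OF that(1)] that(2) LIMSEQ_unique by blast
  have \<psi>_le: "norm (\<psi> f) \<le> B" if "A f p" "\<And>x. x \<in> X \<Longrightarrow> norm (f x) \<le> B" for f p B
  proof (rule field_le_epsilon)
    fix e :: real assume "e > 0"
    show "norm (\<psi> f) \<le> B + e"
      by (rule tendsto_upperbound[OF tendsto_norm[OF \<psi>[OF that(1)]]])
         (use bnd[OF that \<open>e > 0\<close>] in \<open>auto elim: eventually_mono\<close>)
  qed
  define \<phi> where "\<phi> = restrict \<psi> (P_alg X)"
  have sum_in: "(\<lambda>x\<in>X. f x + g x) \<in> P_alg X \<and> \<psi> (\<lambda>x\<in>X. f x + g x) = \<psi> f + \<psi> g"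
    if in_P: "f \<in> P_alg X" "g \<in> P_alg X" for f g
  proof -
    obtain p q where pq: "A f p" "A g q" using in_P P_iff by blast
    have A: "A (\<lambda>x\<in>X. f x + g x) (\<lambda>n x. p n x + q n x)"
      using A_add[OF pq] A_cong[of "\<lambda>x. f x + g x" "\<lambda>x\<in>X. f x + g x"] by auto
    moreover have "\<psi> (\<lambda>x\<in>X. f x + g x) = \<psi> f + \<psi> g"
      using \<psi>_eq[OF A tendsto_add[OF \<psi>[OF pq(1)] \<psi>[OF pq(2)]]] .
    ultimately show ?thesis using P_iff by auto
  qed
  have mult_in: "(\<lambda>x\<in>X. f x * g x) \<in> P_alg X \<and> \<psi> (\<lambda>x\<in>X. f x * g x) = \<psi> f * \<psi> g"
    if ex: "\<exists>p. A f p" "\<exists>p. A g p" for f g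
  proof -
    obtain p q where pq: "A f p" "A g q" using ex by blast
    have A: "A (\<lambda>x\<in>X. f x * g x) (\<lambda>n x. p n x * q n x)"
      using A_mult[OF pq] A_cong[of "\<lambda>x. f x * g x" "\<lambda>x\<in>X. f x * g x"] by auto
    moreover have "\<psi> (\<lambda>x\<in>X. f x * g x) = \<psi> f * \<psi> g"
      using \<psi>_eq[OF A tendsto_mult[OF \<psi>[OF pq(1)] \<psi>[OF pq(2)]]] .
    ultimately show ?thesis using P_iff by auto
  qed
  have \<psi>_poly: "\<psi> p = p z" if "polynomial_map p" for p
    using \<psi>_eq[OF A_const[OF that]] by simp
  have restr: "restrict p X \<in> P_alg X \<and> \<psi> (restrict p X) = p z" if "polynomial_map p" for p
  proof -
    have A: "A (restrict p X) (\<lambda>_. p)" using A_const[OF that] A_cong[of p "restrict p X"] by auto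
    then show ?thesis using \<psi>_eq[OF A] P_iff by auto
  qed
  have scal: "(\<lambda>x\<in>X. c * f x) \<in> P_alg X \<and> \<psi> (\<lambda>x\<in>X. c * f x) = c * \<psi> f" if "f \<in> P_alg X" for c f
    using mult_in[of "\<lambda>_. c" f] A_const[OF polynomial_map_const[of c]] that P_iff
      \<psi>_poly[OF polynomial_map_const[of c]] by auto
  have cont: "\<exists>d>0. \<forall>g\<in>P_alg X. sup_norm X (\<lambda>x. g x - f x) < d \<longrightarrow> norm (\<phi> g - \<phi> f) < e"
    if f: "f \<in> P_alg X" and "e > 0" for f e
  proof (intro exI[of _ e] conjI ballI impI that)
    fix g assume g: "g \<in> P_alg X" and less: "sup_norm X (\<lambda>x. g x - f x) < e"
    obtain p q where pq: "A f p" "A g q" using f g P_iff by blast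
    have "\<psi> (\<lambda>x. g x - f x) = \<psi> g - \<psi> f"
      using \<psi>_eq[OF A_diff[OF pq(2,1)] tendsto_diff[OF \<psi>[OF pq(2)] \<psi>[OF pq(1)]]] .
    moreover have "norm (\<psi> (\<lambda>x. g x - f x)) \<le> sup_norm X (\<lambda>x. g x - f x)"
      using f g by (intro \<psi>_le[OF A_diff[OF pq(2,1)]] norm_le_sup_norm[OF X])
        (auto simp: P_alg_def C_alg_def intro!: continuous_intros)
    ultimately show "norm (\<phi> g - \<phi> f) < e" using f g less by (simp add: \<phi>_def)
  qed
  show ?thesis
  proof (rule ex1I[of _ \<phi>])
    show "mult_functional X \<phi> \<and> (\<forall>p. polynomial_map p \<longrightarrow> \<phi> (restrict p X) = p z)"
      unfolding mult_functional_def
      using sum_in mult_in scal cont restr P_iff by (auto simp: \<phi>_def)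
  next
    fix \<eta> assume \<eta>: "mult_functional X \<eta> \<and> (\<forall>p. polynomial_map p \<longrightarrow> \<eta> (restrict p X) = p z)"
    show "\<eta> = \<phi>"
    proof (rule extensionalityI[of _ "P_alg X"])
      fix f assume f: "f \<in> P_alg X"
      then obtain p where p: "A f p" using P_iff by blast
      have "(\<lambda>n. p n z) \<longlonglongrightarrow> \<eta> f"
        unfolding tendsto_iff
      proof (intro allI impI)
        fix e :: real assume "e > 0"
        then obtain d where d: "d > 0"
            "\<And>g. g \<in> P_alg X \<Longrightarrow> sup_norm X (\<lambda>x. g x - f x) < d \<Longrightarrow> norm (\<eta> g - \<eta> f) < e"
          using \<eta> f unfolding mult_functional_def by meson
        have "\<forall>\<^sub>F n in sequentially. \<forall>x\<in>X. dist (p n x) (f x) < d/2"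
          using uniform_limitD[where S = X and f = p and l = f and F = sequentially and e = "d/2"] p d(1) by (auto simp: A_def)
        then show "\<forall>\<^sub>F n in sequentially. dist (p n z) (\<eta> f) < e"
        proof eventually_elim
          case (elim n)
          have pn: "polynomial_map (p n)" using p by (simp add: A_def)
          have "sup_norm X (\<lambda>x. restrict (p n) X x - f x) \<le> d / 2"
            using elim by (intro sup_norm_le ne) (force simp: dist_norm)
          then show ?case
            using d(2)[of "restrict (p n) X"] restr[OF pn] d(1) \<eta> pn by (simp add: dist_norm)
        qed
      qed
      then have "\<psi> f = \<eta> f" by (rule \<psi>_eq[OF p])
      then show "\<eta> f = \<phi> f" using f by (simp add: \<phi>_def)
    qed (use \<eta> in \<open>auto simp: mult_functional_def \<phi>_def\<close>)
  qed
qed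

definition point_functional ::
    "(complex ^ 'n) set \<Rightarrow> complex ^ 'n \<Rightarrow> (complex ^ 'n \<Rightarrow> complex) \<Rightarrow> complex" where
  "point_functional X z =
     (THE \<phi>. mult_functional X \<phi> \<and>
        (\<forall>p. polynomial_map p \<longrightarrow> \<phi> (restrict p X) = p z))"

definition dual_norm ::
    "(complex ^ 'n) set \<Rightarrow> ((complex ^ 'n \<Rightarrow> complex) \<Rightarrow> complex) \<Rightarrow> real" where
  "dual_norm X \<psi> = (SUP f\<in>{f \<in> P_alg X. sup_norm X f \<le> 1}. norm (\<psi> f))"

definition gleason_rel :: "(complex ^ 'n) set \<Rightarrow> (complex ^ 'n) rel" where
  "gleason_rel X = {(z, w). z \<in> poly_hull X \<and> w \<in> poly_hull X \<and>
     dual_norm X (\<lambda>f. point_functional X z f - point_functional X w f) < 2}"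

definition gleason_parts :: "(complex ^ 'n) set \<Rightarrow> (complex ^ 'n) set set" where
  "gleason_parts X = poly_hull X // gleason_rel X"

end

theory Submission
  imports Defs "HOL-Complex_Analysis.Conformal_Mappings"
begin

text \<open>
  Let p 0, p 1, ... be a sequence of polynomials without zero at x0 that is dense in the
  polynomials, uniformly on compact sets. Everything follows once each of them factors as
    p n = p n x0 * f n * exp (h n)
  where f n and h n are entire, h n x0 = 0, and Re (f n) is at least 1/2 on X.

  Such an f n is invertible in P(X), since 1/f n is a power series in the function
  1 - f n / A for large A. Hence p n is invertible, and density of the sequence gives dense
  invertibles. For the Gleason part, take w in the hull different from x0. The inequality for
  Re (f n) persists at w, so g = exp (h n / s) satisfies g x0 = 1 and, with |p n x0| at least
  1/2, |g|^s is at most 4 |p n| on X and at w. Choose p n close to a polynomial q with q x0 = 1 and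
  q w = 0. The exponent s depends only on the maximum of q on X, so it can first be made so large
  that |g| is at most 1 plus a small number on X, and afterwards p n w can be made so small that
  g w is nearly 0. A Moebius transformation of the disc takes values near 1 and 0 to values near
  1 and -1, so the two point evaluations are at distance 2.

  To obtain the factorizations, put F 0 = 1 and
    F (n + 1) = (p n / p n x0) * exp (m n * (F n - 1)).
  All these functions are 1 at x0. For m n large, Re (F (n + 1)) \<ge> 1/2 forces Re (F n) \<ge> 1/2,
  because p n is bounded. So the frontier points with Re (F n) \<ge> 1/2 form a decreasing sequence
  of compact sets, and X is their intersection. This gives f n = F (n + 1) and
  h n = m n * (1 - F n).

  The remaining point is that x0 lies in the hull of each of these sets
  (maximum_principle_on_frontier), which is where N \<ge> 2 enters. In place of a
  maximum principle on the variety F = 1, one maximizes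
    |g|^2 + eps * |y|^2 - C * (Re (F y) - 1)^2
  over the closure of the domain. With C large, a failure of the claim pushes the maximum to an
  interior point x. There is a complex line through x tangent to the kernel of dF; on it the last
  term changes only to second order in the increment of F, which is of smaller order than the
  strictly subharmonic second term, and this contradicts the maximum principle in one variable.
\<close>

section \<open>Exponential polynomials\<close>

text \<open>The functions F n of the construction arise from polynomials by these operations. With
  generators, holomorphy along lines, gradients and approximability by polynomials are plain
  inductions.\<close>

inductive exp_polynomial :: "(complex ^ 'n \<Rightarrow> complex) \<Rightarrow> bool" where
  const: "exp_polynomial (\<lambda>z. c)"
| coord: "exp_polynomial (\<lambda>z. z $ i)"
| add: "exp_polynomial f \<Longrightarrow> exp_polynomial g \<Longrightarrow> exp_polynomial (\<lambda>z. f z + g z)"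
| mult: "exp_polynomial f \<Longrightarrow> exp_polynomial g \<Longrightarrow> exp_polynomial (\<lambda>z. f z * g z)"
| exp: "exp_polynomial f \<Longrightarrow> exp_polynomial (\<lambda>z. exp (f z))"

lemma exp_polynomial_sum:
  "finite S \<Longrightarrow> (\<And>i. i \<in> S \<Longrightarrow> exp_polynomial (f i)) \<Longrightarrow> exp_polynomial (\<lambda>z. \<Sum>i\<in>S. f i z)"
  by (induction S rule: finite_induct) (auto intro: exp_polynomial.intros)

lemma exp_polynomial_prod:
  "finite S \<Longrightarrow> (\<And>i. i \<in> S \<Longrightarrow> exp_polynomial (f i)) \<Longrightarrow> exp_polynomial (\<lambda>z. \<Prod>i\<in>S. f i z)"
  by (induction S rule: finite_induct) (auto intro: exp_polynomial.intros)

lemma exp_polynomial_power: "exp_polynomial f \<Longrightarrow> exp_polynomial (\<lambda>z. f z ^ k)"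
  by (induction k) (auto intro: exp_polynomial.intros)

lemma polynomial_map_imp_exp_polynomial: "polynomial_map p \<Longrightarrow> exp_polynomial p"
  unfolding polynomial_map_def
  by (auto intro!: exp_polynomial_sum exp_polynomial_prod exp_polynomial_power exp_polynomial.intros)

lemma exp_polynomial_continuous: "exp_polynomial f \<Longrightarrow> continuous_on S f"
  by (induction rule: exp_polynomial.induct) (auto intro!: continuous_intros)

lemma exp_polynomial_holomorphic_on_line:
  "exp_polynomial f \<Longrightarrow> (\<lambda>\<zeta>. f (x + \<zeta> *s v)) holomorphic_on S"
  by (induction rule: exp_polynomial.induct) (auto intro!: holomorphic_intros)

lemma exp_polynomial_gradient:
  fixes f :: "complex ^ 'n \<Rightarrow> complex"
  assumes "exp_polynomial f"
  shows "\<exists>a :: complex ^ 'n. \<forall>v.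
    ((\<lambda>\<zeta>. f (x + \<zeta> *s v)) has_field_derivative (\<Sum>i\<in>UNIV. a $ i * v $ i)) (at 0)"
  using assms
proof (induction rule: exp_polynomial.induct)
  case (const c)
  show ?case by (intro exI[of _ 0]) simp
next
  case (coord i)
  have "(\<Sum>j\<in>UNIV. (axis i 1 :: complex ^ 'n) $ j * v $ j) = v $ i" for v :: "complex ^ 'n"
    by (subst sum.remove[of _ i]) (auto intro!: sum.neutral simp: axis_def)
  then show ?case
    by (intro exI[of _ "axis i 1"]) (auto intro!: derivative_eq_intros)
next
  case (add f g)
  then obtain a b where
    "\<And>v. ((\<lambda>\<zeta>. f (x + \<zeta> *s v)) has_field_derivative (\<Sum>i\<in>UNIV. a $ i * v $ i)) (at 0)"
    "\<And>v. ((\<lambda>\<zeta>. g (x + \<zeta> *s v)) has_field_derivative (\<Sum>i\<in>UNIV. b $ i * v $ i)) (at 0)"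
    by blast
  then show ?case
    by (intro exI[of _ "a + b"])
      (auto intro!: derivative_eq_intros simp: algebra_simps sum.distrib)
next
  case (mult f g)
  then obtain a b where
    "\<And>v. ((\<lambda>\<zeta>. f (x + \<zeta> *s v)) has_field_derivative (\<Sum>i\<in>UNIV. a $ i * v $ i)) (at 0)"
    "\<And>v. ((\<lambda>\<zeta>. g (x + \<zeta> *s v)) has_field_derivative (\<Sum>i\<in>UNIV. b $ i * v $ i)) (at 0)"
    by blast
  then show ?case
    by (intro exI[of _ "g x *s a + f x *s b"])
      (auto intro!: derivative_eq_intros simp: algebra_simps sum.distrib sum_distrib_left)
next
  case (exp f)
  then obtain a where
    "\<And>v. ((\<lambda>\<zeta>. f (x + \<zeta> *s v)) has_field_derivative (\<Sum>i\<in>UNIV. a $ i * v $ i)) (at 0)"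
    by blast
  then show ?case
    by (intro exI[of _ "exp (f x) *s a"])
      (auto intro!: derivative_eq_intros simp: algebra_simps sum_distrib_left)
qed

section \<open>The maximum principle\<close>

lemma linear_form_kernel_nontrivial:
  fixes a :: "complex ^ 'n"
  assumes "CARD('n) \<ge> 2"
  obtains v where "v \<noteq> 0" "(\<Sum>i\<in>UNIV. a $ i * v $ i) = 0"
proof -
  obtain i j :: 'n where ij: "i \<noteq> j"
    using assms by (metis card_2_iff' ex_card top_greatest subset_UNIV)
  have sum_ij: "(\<Sum>k\<in>UNIV. a $ k * (b *s axis i 1 + c *s axis j 1 :: complex ^ 'n) $ k)
      = a $ i * b + a $ j * c" for b c
  proof -
    have "(\<Sum>k\<in>UNIV. a $ k * (b *s axis i 1 + c *s axis j 1 :: complex ^ 'n) $ k)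
        = (\<Sum>k\<in>{i,j}. a $ k * (b *s axis i 1 + c *s axis j 1 :: complex ^ 'n) $ k)"
      by (rule sum.mono_neutral_right) (auto simp: axis_def)
    then show ?thesis using ij by (simp add: axis_def)
  qed
  show thesis
  proof (cases "a $ j = 0")
    case True
    have "(axis j 1 :: complex ^ 'n) \<noteq> 0" by (auto simp: axis_def vec_eq_iff)
    then show thesis using that[of "axis j 1"] sum_ij[of 0 1] True by simp
  next
    case False
    have "(a $ j *s axis i 1 + (- a $ i) *s axis j 1 :: complex ^ 'n) $ i \<noteq> 0"
      using False ij by (simp add: axis_def)
    then have "(a $ j *s axis i 1 + (- a $ i) *s axis j 1 :: complex ^ 'n) \<noteq> 0" by (metis zero_index)
    then show thesis
      using that[of "a $ j *s axis i 1 + (- a $ i) *s axis j 1"] sum_ij[of "a $ j" "- a $ i"]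
      by (simp add: algebra_simps)
  qed
qed

lemma norm_squared_diff:
  fixes a b :: complex
  shows "(norm a)\<^sup>2 - (norm b)\<^sup>2 = 2 * Re (cnj b * (a - b)) + (norm (a - b))\<^sup>2"
  unfolding cmod_power2 by (simp add: power2_eq_square algebra_simps)

lemma Re_constant_if_maximal_at_centre:
  assumes "h holomorphic_on ball 0 d" "d > 0"
    and "\<And>\<zeta>. \<zeta> \<in> ball 0 d \<Longrightarrow> Re (h \<zeta>) \<le> Re (h 0)"
  shows "\<And>\<zeta>. \<zeta> \<in> ball 0 d \<Longrightarrow> Re (h \<zeta>) = Re (h 0)"
proof -
  have "(\<lambda>\<zeta>. exp (h \<zeta>)) constant_on ball 0 d"
  proof (rule maximum_modulus_principle[where U = "ball 0 d" and \<xi> = 0])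
    show "(\<lambda>\<zeta>. exp (h \<zeta>)) holomorphic_on ball 0 d"
      by (intro holomorphic_intros assms)
  qed (use assms in auto)
  then show "Re (h \<zeta>) = Re (h 0)" if "\<zeta> \<in> ball 0 d" for \<zeta>
    using that assms(2) unfolding constant_on_def
    by (metis centre_in_ball norm_exp_eq_Re exp_inj_iff)
qed

text \<open>On the line x + \<zeta> v, with v in the kernel of the differential of f at x, the identity
  |a|^2 - |b|^2 = 2 Re (cnj b (a - b)) + |a - b|^2 splits the increment of the function into the
  real part of a holomorphic function h, the nonnegative terms from |g|^2 and |y|^2, and a penalty
  bounded by C |f(x + \<zeta> v) - f x|^2 = o(|\<zeta>|^2). The term \<epsilon> |v|^2 |\<zeta>|^2 dominates the
  penalty, so at a maximum Re h would be negative near 0 except at 0 itself.\<close>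

lemma no_interior_maximum:
  fixes f g :: "complex ^ 'n \<Rightarrow> complex"
  assumes card: "CARD('n) \<ge> 2" and f: "exp_polynomial f" and g: "exp_polynomial g"
    and U: "open U" "x \<in> U" and \<epsilon>: "\<epsilon> > 0" and C: "C > 0"
    and max: "\<And>y. y \<in> U \<Longrightarrow>
      (norm (g y))\<^sup>2 + \<epsilon> * (\<Sum>i\<in>UNIV. (norm (y $ i))\<^sup>2) - C * (Re (f y) - t)\<^sup>2
      \<le> (norm (g x))\<^sup>2 + \<epsilon> * (\<Sum>i\<in>UNIV. (norm (x $ i))\<^sup>2) - C * (Re (f x) - t)\<^sup>2"
  shows False
proof -
  obtain a where a: "\<And>v. ((\<lambda>\<zeta>. f (x + \<zeta> *s v)) has_field_derivative
      (\<Sum>i\<in>UNIV. a $ i * v $ i)) (at 0)"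
    using exp_polynomial_gradient[OF f] by blast
  obtain v where v: "v \<noteq> 0" "(\<Sum>i\<in>UNIV. a $ i * v $ i) = 0"
    using linear_form_kernel_nontrivial[OF card] by blast
  define L where "L \<zeta> = x + \<zeta> *s v" for \<zeta> :: complex
  define S where "S = (\<Sum>i\<in>UNIV. (norm (v $ i))\<^sup>2)"
  have "S > 0"
  proof -
    obtain i where "v $ i \<noteq> 0" using v(1) by (auto simp: vec_eq_iff)
    then show ?thesis unfolding S_def by (intro sum_pos2[of _ i]) auto
  qed
  have L0 [simp]: "L 0 = x" by (simp add: L_def)
  define h where "h \<zeta> = 2 * cnj (g x) * (g (L \<zeta>) - g x)
      + 2 * of_real \<epsilon> * (\<Sum>i\<in>UNIV. cnj (x $ i) * (\<zeta> * v $ i))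
      - 2 * of_real (C * (Re (f x) - t)) * (f (L \<zeta>) - f x)" for \<zeta>
  have h0: "h 0 = 0" by (simp add: h_def)
  have hol: "h holomorphic_on A" for A
    unfolding h_def L_def
    by (intro holomorphic_intros exp_polynomial_holomorphic_on_line f g)
  have "\<forall>\<^sub>F \<zeta> in nhds 0. L \<zeta> \<in> U"
  proof -
    have "isCont L 0" unfolding L_def by (intro continuous_intros isCont_def[THEN iffD2]
        vec_tendstoI) (auto intro!: tendsto_eq_intros)
    then show ?thesis
      using U by (simp add: continuous_within tendsto_def eventually_nhds_conv_at)
  qed
  moreover have "\<forall>\<^sub>F \<zeta> in nhds 0. C * (norm (f (L \<zeta>) - f x))\<^sup>2 \<le> \<epsilon> * S / 2 * (norm \<zeta>)\<^sup>2"
  proof -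
    \<comment> \<open>chosen so that an increment of f below \<eta> |\<zeta>| costs at most half of \<epsilon> |v|^2 |\<zeta>|^2\<close>
    define \<eta> where "\<eta> = sqrt (\<epsilon> * S / (2 * C))"
    have \<eta>: "\<eta> > 0" "C * \<eta>\<^sup>2 = \<epsilon> * S / 2"
      using \<epsilon> C \<open>S > 0\<close> by (auto simp: \<eta>_def field_simps)
    have "((\<lambda>\<zeta>. (f (L \<zeta>) - f x) / \<zeta>) \<longlongrightarrow> 0) (at 0)"
      using a[of v] v(2) by (simp add: L_def has_field_derivative_iff)
    then have "\<forall>\<^sub>F \<zeta> in at 0. norm ((f (L \<zeta>) - f x) / \<zeta>) < \<eta>"
      using \<eta>(1) by (auto simp: tendsto_iff)
    then have "\<forall>\<^sub>F \<zeta> in nhds 0. \<zeta> \<noteq> 0 \<longrightarrow> norm ((f (L \<zeta>) - f x) / \<zeta>) < \<eta>"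
      by (simp add: eventually_at_filter)
    then show ?thesis
    proof eventually_elim
      case (elim \<zeta>)
      have "norm (f (L \<zeta>) - f x) \<le> \<eta> * norm \<zeta>"
        using elim by (cases "\<zeta> = 0") (auto simp: norm_divide field_simps)
      then have "C * (norm (f (L \<zeta>) - f x))\<^sup>2 \<le> C * (\<eta> * norm \<zeta>)\<^sup>2"
        using C by (intro mult_left_mono power_mono) auto
      also have "\<dots> = \<epsilon> * S / 2 * (norm \<zeta>)\<^sup>2" by (simp add: power_mult_distrib flip: \<eta>(2))
      finally show ?case .
    qed
  qed
  ultimately have "\<forall>\<^sub>F \<zeta> in nhds 0. Re (h \<zeta>) \<le> - (\<epsilon> * S / 2 * (norm \<zeta>)\<^sup>2)"
  proof eventually_elim
    case (elim \<zeta>)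
    have 1: "(norm (g (L \<zeta>)))\<^sup>2 - (norm (g x))\<^sup>2 \<ge> 2 * Re (cnj (g x) * (g (L \<zeta>) - g x))"
      by (simp add: norm_squared_diff)
    have 2: "(\<Sum>i\<in>UNIV. (norm (L \<zeta> $ i))\<^sup>2) - (\<Sum>i\<in>UNIV. (norm (x $ i))\<^sup>2) =
        2 * Re (\<Sum>i\<in>UNIV. cnj (x $ i) * (\<zeta> * v $ i)) + (norm \<zeta>)\<^sup>2 * S"
      unfolding S_def sum_distrib_left Re_sum sum_subtractf[symmetric] sum.distrib[symmetric]
      by (intro sum.cong refl, subst norm_squared_diff)
        (simp add: L_def norm_mult power_mult_distrib)
    have "(Re (f (L \<zeta>)) - Re (f x))\<^sup>2 \<le> (norm (f (L \<zeta>) - f x))\<^sup>2"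
      by (metis abs_Re_le_cmod abs_le_square_iff abs_norm_cancel minus_complex.sel(1))
    then have "C * (Re (f (L \<zeta>)) - Re (f x))\<^sup>2 \<le> \<epsilon> * S / 2 * (norm \<zeta>)\<^sup>2"
      using elim(2) C by (meson mult_left_mono order.trans order_less_imp_le)
    moreover have "C * (Re (f (L \<zeta>)) - t)\<^sup>2 - C * (Re (f x) - t)\<^sup>2 =
        C * (Re (f (L \<zeta>)) - Re (f x))\<^sup>2 + 2 * C * (Re (f x) - t) * Re (f (L \<zeta>) - f x)"
      by (simp add: power2_eq_square algebra_simps)
    ultimately have 3: "C * (Re (f (L \<zeta>)) - t)\<^sup>2 - C * (Re (f x) - t)\<^sup>2 \<le>
        \<epsilon> * S / 2 * (norm \<zeta>)\<^sup>2 + 2 * C * (Re (f x) - t) * Re (f (L \<zeta>) - f x)"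
      by linarith
    have h: "Re (h \<zeta>) = 2 * Re (cnj (g x) * (g (L \<zeta>) - g x))
        + \<epsilon> * (2 * Re (\<Sum>i\<in>UNIV. cnj (x $ i) * (\<zeta> * v $ i)))
        - 2 * C * (Re (f x) - t) * Re (f (L \<zeta>) - f x)"
      unfolding h_def by (simp add: algebra_simps)
    have 4: "\<epsilon> * (\<Sum>i\<in>UNIV. (norm (L \<zeta> $ i))\<^sup>2) - \<epsilon> * (\<Sum>i\<in>UNIV. (norm (x $ i))\<^sup>2) =
        \<epsilon> * (2 * Re (\<Sum>i\<in>UNIV. cnj (x $ i) * (\<zeta> * v $ i))) + \<epsilon> * S * (norm \<zeta>)\<^sup>2"
      using arg_cong[OF 2, of "\<lambda>s. \<epsilon> * s"] by (simp add: algebra_simps)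
    have 5: "\<epsilon> * S / 2 * (norm \<zeta>)\<^sup>2 = \<epsilon> * S * (norm \<zeta>)\<^sup>2 / 2" by simp
    show ?case using 1 3[unfolded 5] 4 h max[OF elim(1)] unfolding 5 by argo
  qed
  then obtain d where d: "d > 0"
      "\<And>\<zeta>. \<zeta> \<in> ball 0 d \<Longrightarrow> Re (h \<zeta>) \<le> - (\<epsilon> * S / 2 * (norm \<zeta>)\<^sup>2)"
    unfolding eventually_nhds_metric by (auto simp: dist_commute)
  have pos: "\<epsilon> * S / 2 * (norm \<zeta>)\<^sup>2 \<ge> 0" for \<zeta> :: complex using \<epsilon> \<open>S > 0\<close> by simp
  have "Re (h (of_real (d / 2))) = Re (h 0)"
  proof (rule Re_constant_if_maximal_at_centre[OF hol d(1)])
    show "Re (h \<zeta>) \<le> Re (h 0)" if "\<zeta> \<in> ball 0 d" for \<zeta>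
      using d(2)[OF that] pos[of \<zeta>] h0 by simp
  qed (use d(1) in auto)
  moreover have "Re (h (of_real (d / 2))) \<le> - (\<epsilon> * S / 2 * (norm (of_real (d / 2) :: complex))\<^sup>2)"
    using d(1) by (intro d(2)) auto
  moreover have "\<epsilon> * S / 2 * (norm (of_real (d / 2) :: complex))\<^sup>2 > 0"
    using \<epsilon> \<open>S > 0\<close> d(1) by (intro mult_pos_pos zero_less_power) auto
  ultimately show False using h0 by simp
qed

text \<open>In one variable the analogous statement fails: on the unit disc with f z = 1 + z and c = 1/2,
  the set of frontier points is a proper arc of the circle, which is polynomially convex, so some
  polynomial is larger at 0 than on the arc. The second dimension provides the tangent line used in
  the previous lemma.\<close>

lemma maximum_principle_on_frontier:
  fixes f g :: "complex ^ 'n \<Rightarrow> complex"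
  assumes card: "CARD('n) \<ge> 2" and \<Omega>: "open \<Omega>" "bounded \<Omega>" "x\<^sub>0 \<in> \<Omega>"
    and f: "exp_polynomial f" and g: "exp_polynomial g" and c: "c < Re (f x\<^sub>0)"
  shows "\<exists>y\<in>frontier \<Omega>. Re (f y) \<ge> c \<and> norm (g x\<^sub>0) \<le> norm (g y)"
proof (rule ccontr)
  assume "\<not> ?thesis"
  then have less: "norm (g y) < norm (g x\<^sub>0)" if "y \<in> frontier \<Omega>" "Re (f y) \<ge> c" for y
    using that by force
  define t where "t = Re (f x\<^sub>0)"
  define sq where "sq y = (\<Sum>i\<in>UNIV. (norm (y $ i))\<^sup>2)" for y :: "complex ^ 'n"
  have cont: "continuous_on A f" "continuous_on A g" "continuous_on A sq" for A
    using f g by (auto simp: sq_def intro!: exp_polynomial_continuous continuous_intros)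
  have K: "compact (closure \<Omega>)" using \<Omega>(2) by (simp add: compact_closure)
  have Y: "compact {y \<in> frontier \<Omega>. Re (f y) \<ge> c}"
  proof -
    have "closed (frontier \<Omega> \<inter> (\<lambda>y. Re (f y)) -` {c..})"
      by (intro continuous_closed_preimage continuous_intros cont) auto
    moreover have "frontier \<Omega> \<inter> (\<lambda>y. Re (f y)) -` {c..} = {y \<in> frontier \<Omega>. Re (f y) \<ge> c}"
      by auto
    ultimately show ?thesis
      using bounded_subset[OF compact_imp_bounded[OF compact_frontier_bounded[OF \<Omega>(2)]]]
      by (simp add: compact_eq_bounded_closed)
  qed
  obtain \<beta> where \<beta>: "\<beta> > 0"
    "\<And>y. y \<in> frontier \<Omega> \<Longrightarrow> Re (f y) \<ge> c \<Longrightarrow> (norm (g y))\<^sup>2 + \<beta> \<le> (norm (g x\<^sub>0))\<^sup>2"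
  proof (cases "{y \<in> frontier \<Omega>. Re (f y) \<ge> c} = {}")
    case True
    then show thesis using that[of 1] by force
  next
    case False
    then obtain y where y: "y \<in> frontier \<Omega>" "Re (f y) \<ge> c"
        "\<And>u. u \<in> frontier \<Omega> \<Longrightarrow> Re (f u) \<ge> c \<Longrightarrow> norm (g u) \<le> norm (g y)"
      using continuous_attains_sup[OF Y False continuous_on_norm[OF cont(2)]] by auto
    show thesis
    proof (rule that[of "(norm (g x\<^sub>0))\<^sup>2 - (norm (g y))\<^sup>2"])
      show "(norm (g x\<^sub>0))\<^sup>2 - (norm (g y))\<^sup>2 > 0"
        using less[OF y(1,2)] by (simp add: power_strict_mono)
    qed (use y(3) in \<open>simp add: power_mono\<close>)
  qed
  have bound: "\<exists>B>0. \<forall>y\<in>closure \<Omega>. u y \<le> B" if "continuous_on (closure \<Omega>) u" for u :: "_ \<Rightarrow> real"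
  proof -
    have "bounded (u ` closure \<Omega>)"
      using compact_continuous_image[OF that K] compact_imp_bounded by blast
    then obtain B where "B > 0" "\<forall>y\<in>closure \<Omega>. norm (u y) \<le> B" by (auto simp: bounded_pos)
    then show ?thesis by (intro exI[of _ B]) fastforce
  qed
  obtain B where B: "B > 0" "\<And>y. y \<in> closure \<Omega> \<Longrightarrow> sq y \<le> B"
    using bound[OF cont(3)] by blast
  obtain G where G: "G > 0" "\<And>y. y \<in> closure \<Omega> \<Longrightarrow> (norm (g y))\<^sup>2 \<le> G"
    using bound[of "\<lambda>y. (norm (g y))\<^sup>2"] cont(2) by (force intro!: continuous_intros)
  \<comment> \<open>\<epsilon> is small against the gap \<beta> on the part of the frontier with Re f \<ge> c; C makes
    the penalty outweigh |g|^2 on the rest\<close>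
  define \<epsilon> where "\<epsilon> = \<beta> / (2 * B)"
  define C where "C = (G + \<beta>) / (t - c)\<^sup>2"
  have \<epsilon>: "\<epsilon> > 0" "\<epsilon> * B = \<beta> / 2" using \<beta>(1) B(1) by (auto simp: \<epsilon>_def)
  have C: "C > 0" "C * (t - c)\<^sup>2 = G + \<beta>" using \<beta>(1) G(1) c by (auto simp: C_def t_def)
  define \<Phi> where "\<Phi> y = (norm (g y))\<^sup>2 + \<epsilon> * sq y - C * (Re (f y) - t)\<^sup>2" for y
  have "continuous_on (closure \<Omega>) \<Phi>"
    unfolding \<Phi>_def by (intro continuous_intros cont)
  then obtain x where x: "x \<in> closure \<Omega>" "\<And>y. y \<in> closure \<Omega> \<Longrightarrow> \<Phi> y \<le> \<Phi> x"
    using continuous_attains_sup[OF K, of \<Phi>] \<Omega>(3) closure_subset by blast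
  have "sq x\<^sub>0 \<ge> 0" by (simp add: sq_def sum_nonneg)
  then have "\<Phi> x\<^sub>0 \<ge> (norm (g x\<^sub>0))\<^sup>2" using \<epsilon>(1) by (simp add: \<Phi>_def t_def)
  then have \<Phi>x: "\<Phi> x \<ge> (norm (g x\<^sub>0))\<^sup>2" using x(2)[of x\<^sub>0] \<Omega>(3) closure_subset by force
  have "x \<notin> frontier \<Omega>"
  proof
    assume fr: "x \<in> frontier \<Omega>"
    have sq: "\<epsilon> * sq x \<le> \<beta> / 2"
      using mult_left_mono[OF B(2)[OF x(1)], of \<epsilon>] \<epsilon> by simp
    show False
    proof (cases "Re (f x) \<ge> c")
      case True
      have "C * (Re (f x) - t)\<^sup>2 \<ge> 0" using C(1) by simp
      then show False using \<beta>(2)[OF fr True] sq \<Phi>x \<beta>(1) unfolding \<Phi>_def by linarith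
    next
      case False
      then have "(t - c)\<^sup>2 \<le> (Re (f x) - t)\<^sup>2"
        using c unfolding t_def by (subst (2) power2_commute, intro power_mono) auto
      then have "G + \<beta> \<le> C * (Re (f x) - t)\<^sup>2" unfolding C(2)[symmetric] using C(1) by simp
      moreover have "(norm (g x\<^sub>0))\<^sup>2 \<ge> 0" by simp
      ultimately show False using G(2)[OF x(1)] sq \<Phi>x \<beta>(1) unfolding \<Phi>_def by linarith
    qed
  qed
  then have "x \<in> \<Omega>" using x(1) \<Omega>(1) by (simp add: frontier_def interior_open)
  then show False
    using no_interior_maximum[OF card f g \<Omega>(1) _ \<epsilon>(1) C(1), of x t] x(2) closure_subset
    unfolding \<Phi>_def sq_def by blast
qed

section \<open>Uniform approximation by polynomials\<close>

text \<open>The set Y will be X together with one or two points of its hull. Approximating on the larger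
  set lets functions be evaluated at hull points directly.\<close>

definition poly_approx :: "(complex ^ 'n) set \<Rightarrow> (complex ^ 'n \<Rightarrow> complex) \<Rightarrow> bool" where
  "poly_approx Y F \<longleftrightarrow> (\<forall>e>0. \<exists>p. polynomial_map p \<and> (\<forall>x\<in>Y. norm (F x - p x) < e))"

lemma poly_approx_polynomial: "polynomial_map p \<Longrightarrow> poly_approx Y p"
  unfolding poly_approx_def by (auto intro!: exI[of _ p])

lemma poly_approx_limit:
  assumes "\<And>e. e > 0 \<Longrightarrow> \<exists>G. poly_approx Y G \<and> (\<forall>x\<in>Y. norm (F x - G x) < e)"
  shows "poly_approx Y F"
  unfolding poly_approx_def
proof (intro allI impI)
  fix e :: real assume "e > 0"
  then obtain G where G: "poly_approx Y G" "\<forall>x\<in>Y. norm (F x - G x) < e / 2"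
    using assms[of "e / 2"] by auto
  then obtain p where p: "polynomial_map p" "\<forall>x\<in>Y. norm (G x - p x) < e / 2"
    unfolding poly_approx_def using \<open>e > 0\<close> by (meson half_gt_zero)
  have "norm (F x - p x) < e" if "x \<in> Y" for x
    using norm_diff_triangle_less[of "F x" "G x" "e/2" "p x" "e/2"] G(2) p(2) that by simp
  then show "\<exists>p. polynomial_map p \<and> (\<forall>x\<in>Y. norm (F x - p x) < e)" using p(1) by blast
qed

lemma poly_approx_cong:
  "poly_approx Y F \<Longrightarrow> (\<And>x. x \<in> Y \<Longrightarrow> F x = G x) \<Longrightarrow> poly_approx Y G"
  unfolding poly_approx_def by (metis (no_types, lifting))

lemma poly_approx_subset: "poly_approx Y F \<Longrightarrow> Z \<subseteq> Y \<Longrightarrow> poly_approx Z F"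
  unfolding poly_approx_def by (meson subsetD)

lemma poly_approx_add:
  assumes "poly_approx Y F" "poly_approx Y G"
  shows "poly_approx Y (\<lambda>x. F x + G x)"
  unfolding poly_approx_def
proof (intro allI impI)
  fix e :: real assume "e > 0"
  then obtain p q where "polynomial_map p" "\<forall>x\<in>Y. norm (F x - p x) < e / 2"
      "polynomial_map q" "\<forall>x\<in>Y. norm (G x - q x) < e / 2"
    using assms unfolding poly_approx_def by (meson half_gt_zero)
  then show "\<exists>p. polynomial_map p \<and> (\<forall>x\<in>Y. norm (F x + G x - p x) < e)"
    by (intro exI[of _ "\<lambda>x. p x + q x"] conjI ballI polynomial_map_add norm_diff_triangle_ineq[THEN order.strict_trans1]) fastforce+
qed

lemma poly_approx_uniform_limit:
  assumes "poly_approx Y F"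
  obtains p where "\<And>n. polynomial_map (p n)" "uniform_limit Y p F sequentially"
proof -
  have "\<forall>n. \<exists>p. polynomial_map p \<and> (\<forall>x\<in>Y. norm (F x - p x) < 1 / real (Suc n))"
    using assms unfolding poly_approx_def by simp
  then obtain p where p: "\<And>n. polynomial_map (p n)"
      "\<And>n x. x \<in> Y \<Longrightarrow> norm (F x - p n x) < 1 / real (Suc n)" by metis
  have "uniform_limit Y p F sequentially"
  proof (rule uniform_limitI)
    fix e :: real assume "e > 0"
    then have "\<forall>\<^sub>F n in sequentially. 1 / real (Suc n) < e"
      using order_tendstoD(2)[OF LIMSEQ_inverse_real_of_nat] by (simp add: inverse_eq_divide)
    then show "\<forall>\<^sub>F n in sequentially. \<forall>x\<in>Y. dist (p n x) (F x) < e"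
    proof eventually_elim
      case (elim n)
      then show ?case using p(2)[of _ n] by (fastforce simp: dist_norm norm_minus_commute)
    qed
  qed
  then show thesis using that p(1) by blast
qed

lemma poly_approx_of_uniform_limit:
  assumes "\<And>n. poly_approx Y (p n)" "uniform_limit Y p F sequentially"
  shows "poly_approx Y F"
proof (rule poly_approx_limit)
  fix e :: real assume "e > 0"
  then have "\<forall>\<^sub>F n in sequentially. \<forall>x\<in>Y. dist (p n x) (F x) < e"
    using uniform_limitD[OF assms(2)] by simp
  then obtain n where "\<forall>x\<in>Y. dist (p n x) (F x) < e"
    using eventually_happens'[OF sequentially_bot] by blast
  then show "\<exists>G. poly_approx Y G \<and> (\<forall>x\<in>Y. norm (F x - G x) < e)"
    using assms(1)[of n] by (intro exI[of _ "p n"]) (auto simp: dist_norm norm_minus_commute)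
qed

lemma poly_approx_continuous:
  assumes "poly_approx Y F" shows "continuous_on Y F"
proof -
  obtain p where p: "\<And>n. polynomial_map (p n)" "uniform_limit Y p F sequentially"
    using poly_approx_uniform_limit[OF assms] by blast
  show ?thesis
    by (rule uniform_limit_theorem[OF _ p(2)])
      (auto intro!: always_eventually polynomial_map_continuous p(1))
qed

lemma poly_approx_bounded:
  assumes "poly_approx Y F" "compact Y"
  obtains B where "B > 0" "\<And>x. x \<in> Y \<Longrightarrow> norm (F x) \<le> B"
proof -
  have "bounded (F ` Y)"
    using compact_continuous_image[OF poly_approx_continuous[OF assms(1)] assms(2)]
      compact_imp_bounded by blast
  then show thesis using that by (auto simp: bounded_pos)
qed

lemma poly_approx_mult:
  assumes F: "poly_approx Y F" and G: "poly_approx Y G" and Y: "compact Y"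
  shows "poly_approx Y (\<lambda>x. F x * G x)"
proof -
  obtain p where p: "\<And>n. polynomial_map (p n)" "uniform_limit Y p F sequentially"
    using poly_approx_uniform_limit[OF F] by blast
  obtain q where q: "\<And>n. polynomial_map (q n)" "uniform_limit Y q G sequentially"
    using poly_approx_uniform_limit[OF G] by blast
  have "bounded (F ` Y)" "bounded (G ` Y)"
    using compact_continuous_image[OF poly_approx_continuous Y] F G compact_imp_bounded by blast+
  then have "uniform_limit Y (\<lambda>n x. p n x * q n x) (\<lambda>x. F x * G x) sequentially"
    by (intro uniform_lim_mult p q)
  then show ?thesis
    by (rule poly_approx_of_uniform_limit[rotated])
      (intro poly_approx_polynomial polynomial_map_mult p q)
qed

lemma poly_approx_const: "poly_approx Y (\<lambda>x. c)"
  by (intro poly_approx_polynomial polynomial_map_const)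

lemma poly_approx_diff:
  assumes "poly_approx Y F" "poly_approx Y G" "compact Y"
  shows "poly_approx Y (\<lambda>x. F x - G x)"
  using poly_approx_add[OF assms(1) poly_approx_mult[OF poly_approx_const[of _ "-1"] assms(2,3)]]
  by simp

text \<open>This covers both the exponential series and the geometric series for inverses.\<close>

lemma poly_approx_power_series:
  fixes a :: "nat \<Rightarrow> complex"
  assumes F: "poly_approx Y F" and Y: "compact Y"
    and r: "\<And>x. x \<in> Y \<Longrightarrow> norm (F x) \<le> r" "ereal r < conv_radius a"
  shows "poly_approx Y (\<lambda>x. \<Sum>i. a i * F x ^ i)"
proof -
  have power: "poly_approx Y (\<lambda>x. F x ^ i)" for i
    by (induction i) (auto intro!: poly_approx_const poly_approx_mult F Y)
  have partial: "poly_approx Y (\<lambda>x. \<Sum>i<n. a i * F x ^ i)" for n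
    by (induction n) (auto intro!: poly_approx_const poly_approx_mult poly_approx_add power Y)
  have "uniform_limit (cball 0 r) (\<lambda>n x. \<Sum>i<n. a i * (x - 0) ^ i) (\<lambda>x. \<Sum>i. a i * (x - 0) ^ i)
      sequentially"
    by (rule powser_uniform_limit[OF r(2)])
  then have "uniform_limit Y (\<lambda>n x. \<Sum>i<n. a i * F x ^ i) (\<lambda>x. \<Sum>i. a i * F x ^ i) sequentially"
    unfolding uniform_limit_iff using r(1) by (auto elim!: eventually_mono simp: dist_norm)
  then show ?thesis by (rule poly_approx_of_uniform_limit[OF partial])
qed

lemma poly_approx_exp:
  assumes "poly_approx Y F" "compact Y"
  shows "poly_approx Y (\<lambda>x. exp (F x))"
proof -
  obtain B where "\<And>x. x \<in> Y \<Longrightarrow> norm (F x) \<le> B"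
    using poly_approx_bounded[OF assms] by blast
  then have "poly_approx Y (\<lambda>x. \<Sum>i. inverse (fact i) * F x ^ i)"
    by (intro poly_approx_power_series[OF assms, of B])
      (simp_all add: conv_radius_inftyI''[OF summable_exp])
  then show ?thesis by (simp add: exp_def scaleR_conv_of_real)
qed

lemma poly_approx_inverse_near_1:
  assumes F: "poly_approx Y F" and Y: "compact Y"
    and r: "\<And>x. x \<in> Y \<Longrightarrow> norm (1 - F x) \<le> r" "r < 1"
  shows "poly_approx Y (\<lambda>x. 1 / F x)"
proof (rule poly_approx_cong)
  show "poly_approx Y (\<lambda>x. \<Sum>i. 1 * (1 - F x) ^ i)"
  proof (intro poly_approx_power_series[where r = r] poly_approx_diff poly_approx_const F Y r)
    define s where "s = max 0 ((1 + r) / 2)"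
    have s: "0 \<le> s" "r < s" "s < 1" using r(2) by (auto simp: s_def less_max_iff_disj field_simps)
    have "ereal (norm (of_real s :: complex)) \<le> conv_radius (\<lambda>i. 1 :: complex)"
      by (rule conv_radius_geI) (use s in \<open>simp add: summable_geometric\<close>)
    then show "ereal r < conv_radius (\<lambda>i. 1 :: complex)"
      using s by (metis abs_of_nonneg ereal_less_eq(3) less_ereal.simps(1) norm_of_real order.strict_trans1 order_less_le_trans)
  qed
  show "(\<Sum>i. 1 * (1 - F x) ^ i) = 1 / F x" if "x \<in> Y" for x
    using r that suminf_geometric[of "1 - F x"] by force
qed

text \<open>A bounded part of a half plane that avoids 0 lies in a disc |A - z| \<le> r A with r < 1 around a
  large real A, where 1/z is a geometric series.\<close>

lemma poly_approx_inverse_half_plane: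
  assumes F: "poly_approx Y F" and Y: "compact Y"
    and c: "\<And>x. x \<in> Y \<Longrightarrow> Re (F x) \<ge> c" "c > 0"
  shows "poly_approx Y (\<lambda>x. 1 / F x)"
proof -
  obtain B where B: "B > 0" "\<And>x. x \<in> Y \<Longrightarrow> norm (F x) \<le> B"
    using poly_approx_bounded[OF F Y] by blast
  define A where "A = B\<^sup>2 / c"
  have A: "A > 0" using B(1) c(2) by (simp add: A_def)
  define r where "r = sqrt (1 - c / A)"
  have "norm (1 - of_real (1 / A) * F x) \<le> r" if "x \<in> Y" for x
  proof -
    have "(norm (1 - of_real (1 / A) * F x))\<^sup>2 = 1 - 2 * Re (F x) / A + (norm (F x))\<^sup>2 / A\<^sup>2"
      unfolding cmod_power2 using A by (simp add: power2_eq_square field_simps)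
    also have "\<dots> \<le> 1 - 2 * c / A + B\<^sup>2 / A\<^sup>2"
      using A B c(1) that
      by (intro add_mono diff_mono divide_right_mono mult_left_mono power_mono) auto
    also have "B\<^sup>2 / A\<^sup>2 = c / A" using A c(2) B(1) by (simp add: A_def power2_eq_square field_simps)
    also have "1 - 2 * c / A + c / A = 1 - c / A" using A by (simp add: field_simps)
    finally show ?thesis unfolding r_def by (rule real_le_rsqrt)
  qed
  moreover have "r < 1" using A c(2) by (simp add: r_def)
  ultimately have "poly_approx Y (\<lambda>x. 1 / (of_real (1 / A) * F x))"
    by (intro poly_approx_inverse_near_1 poly_approx_mult poly_approx_const F Y)
  from poly_approx_mult[OF poly_approx_const[of _ "of_real (1 / A)"] this Y] show ?thesis
    using A by simp
qed

lemma exp_polynomial_poly_approx: "exp_polynomial F \<Longrightarrow> compact Y \<Longrightarrow> poly_approx Y F"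
proof (induction rule: exp_polynomial.induct)
  case (coord i)
  show ?case by (intro poly_approx_polynomial polynomial_map_coord)
qed (simp_all add: poly_approx_const poly_approx_add poly_approx_mult poly_approx_exp)

section \<open>Hulls and point functionals\<close>

lemma poly_hull_bound:
  assumes w: "w \<in> poly_hull X" and F: "poly_approx (insert w X) F"
    and B: "\<And>x. x \<in> X \<Longrightarrow> norm (F x) \<le> B"
  shows "norm (F w) \<le> B"
proof (rule field_le_epsilon)
  fix e :: real assume "e > 0"
  then obtain p where p: "polynomial_map p" "\<And>x. x \<in> insert w X \<Longrightarrow> norm (F x - p x) < e / 2"
    using F unfolding poly_approx_def by (meson half_gt_zero)
  have "norm (p w) \<le> sup_norm X p" using w p(1) by (simp add: poly_hull_def)
  also have "\<dots> \<le> B + e / 2"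
  proof (rule sup_norm_le[OF poly_hull_nonempty[OF w]])
    fix x assume "x \<in> X"
    then show "norm (p x) \<le> B + e / 2"
      using B[of x] p(2)[of x] norm_triangle_ineq2[of "p x" "F x"] by (simp add: norm_minus_commute)
  qed
  finally show "norm (F w) \<le> B + e"
    using p(2)[of w] norm_triangle_ineq2[of "F w" "p w"] by simp
qed

text \<open>Half planes are compared through the modulus of exp (-F).\<close>

lemma poly_hull_Re_ge:
  assumes w: "w \<in> poly_hull X" and X: "compact X" and F: "poly_approx (insert w X) F"
    and c: "\<And>x. x \<in> X \<Longrightarrow> c \<le> Re (F x)"
  shows "c \<le> Re (F w)"
proof -
  have "poly_approx (insert w X) (\<lambda>x. exp (- 1 * F x))"
    using X by (intro poly_approx_exp poly_approx_mult poly_approx_const F) auto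
  then have "norm (exp (- 1 * F w)) \<le> exp (- c)"
    by (rule poly_hull_bound[OF w]) (use c in auto)
  then show ?thesis by simp
qed

lemma restrict_in_P_alg_iff:
  assumes X: "compact X" "X \<noteq> {}"
  shows "restrict F X \<in> P_alg X \<longleftrightarrow> poly_approx X F"
proof
  assume "poly_approx X F"
  then obtain p where p: "\<And>n. polynomial_map (p n)" "uniform_limit X p F sequentially"
    using poly_approx_uniform_limit by blast
  from p(2) have "uniform_limit X p (restrict F X) sequentially"
    unfolding uniform_limit_iff by simp
  then show "restrict F X \<in> P_alg X" using p(1) by (auto simp: P_alg_iff[OF X])
next
  assume "restrict F X \<in> P_alg X"
  then obtain p where p: "\<And>n. polynomial_map (p n)" "uniform_limit X p (restrict F X) sequentially"
    by (auto simp: P_alg_iff[OF X])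
  have "poly_approx X (restrict F X)"
    by (rule poly_approx_of_uniform_limit[OF _ p(2)]) (intro poly_approx_polynomial p(1))
  then show "poly_approx X F" by (rule poly_approx_cong) simp
qed

lemma P_alg_restrict_eq: "f \<in> P_alg X \<Longrightarrow> restrict f X = f"
  by (simp add: P_alg_def C_alg_def extensional_restrict)

lemma point_functional_properties:
  assumes "compact X" "z \<in> poly_hull X"
  shows "mult_functional X (point_functional X z)"
    and "polynomial_map p \<Longrightarrow> point_functional X z (restrict p X) = p z"
  using theI'[OF point_functional_ex1[OF assms]] unfolding point_functional_def by blast+

text \<open>The continuity of the functional, read off on polynomials only; the next two lemmas use it to
  transport values and bounds from polynomials to P(X).\<close>

lemma point_functional_approx:
  assumes X: "compact X" and z: "z \<in> poly_hull X" and f: "f \<in> P_alg X" and e: "e > 0"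
  obtains d where "d > 0" "\<And>p. polynomial_map p \<Longrightarrow> (\<And>x. x \<in> X \<Longrightarrow> norm (f x - p x) \<le> d) \<Longrightarrow>
    norm (p z - point_functional X z f) < e"
proof -
  have ne: "X \<noteq> {}" using poly_hull_nonempty[OF z] .
  obtain d where d: "d > 0" "\<And>g. g \<in> P_alg X \<Longrightarrow> sup_norm X (\<lambda>x. g x - f x) < d \<Longrightarrow>
      norm (point_functional X z g - point_functional X z f) < e"
    using point_functional_properties(1)[OF X z] f e unfolding mult_functional_def by meson
  show thesis
  proof (rule that[of "d / 2"])
    fix p assume p: "polynomial_map p" "\<And>x. x \<in> X \<Longrightarrow> norm (f x - p x) \<le> d / 2"
    have "sup_norm X (\<lambda>x. restrict p X x - f x) \<le> d / 2"
      using p(2) by (intro sup_norm_le ne) (simp add: norm_minus_commute)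
    moreover have "restrict p X \<in> P_alg X"
      using restrict_in_P_alg_iff[OF X ne] poly_approx_polynomial[OF p(1)] by blast
    ultimately show "norm (p z - point_functional X z f) < e"
      using d(2)[of "restrict p X"] d(1) point_functional_properties(2)[OF X z p(1)] by simp
  qed (use d(1) in simp)
qed

lemma point_functional_eval:
  assumes X: "compact X" and z: "z \<in> poly_hull X" and F: "poly_approx (insert z X) F"
  shows "point_functional X z (restrict F X) = F z"
proof -
  have "X \<noteq> {}" using poly_hull_nonempty[OF z] .
  moreover have "poly_approx X F" using poly_approx_subset[OF F] by blast
  ultimately have f: "restrict F X \<in> P_alg X" using restrict_in_P_alg_iff[OF X] by blast
  have "norm (F z - point_functional X z (restrict F X)) \<le> 0 + e" if "e > 0" for e
  proof -
    obtain d where d: "d > 0" "\<And>p. polynomial_map p \<Longrightarrow>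
        (\<And>x. x \<in> X \<Longrightarrow> norm (restrict F X x - p x) \<le> d) \<Longrightarrow>
        norm (p z - point_functional X z (restrict F X)) < e / 2"
      using point_functional_approx[OF X z f, of "e / 2"] \<open>e > 0\<close> by auto
    obtain p where p: "polynomial_map p" "\<And>x. x \<in> insert z X \<Longrightarrow> norm (F x - p x) < min d (e / 2)"
      using F d(1) \<open>e > 0\<close> unfolding poly_approx_def
      by (meson half_gt_zero min_less_iff_conj)
    have "norm (p z - point_functional X z (restrict F X)) < e / 2"
      using p by (intro d(2)) force+
    then show ?thesis
      using p(2)[of z] norm_diff_triangle_less[of "F z" "p z" "e/2"] by fastforce
  qed
  then have "norm (F z - point_functional X z (restrict F X)) \<le> 0" by (rule field_le_epsilon)
  then show ?thesis by simp
qed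

lemma point_functional_norm_le:
  assumes X: "compact X" and z: "z \<in> poly_hull X" and f: "f \<in> P_alg X"
  shows "norm (point_functional X z f) \<le> sup_norm X f"
proof (rule field_le_epsilon)
  fix e :: real assume "e > 0"
  have ne: "X \<noteq> {}" using poly_hull_nonempty[OF z] .
  have approx: "poly_approx X f"
    using restrict_in_P_alg_iff[OF X ne, of f] f P_alg_restrict_eq[OF f] by simp
  obtain d where d: "d > 0" "\<And>p. polynomial_map p \<Longrightarrow> (\<And>x. x \<in> X \<Longrightarrow> norm (f x - p x) \<le> d) \<Longrightarrow>
      norm (p z - point_functional X z f) < e / 2"
    using point_functional_approx[OF X z f, of "e / 2"] \<open>e > 0\<close> by auto
  obtain p where p: "polynomial_map p" "\<And>x. x \<in> X \<Longrightarrow> norm (f x - p x) < min d (e / 2)"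
    using approx d(1) \<open>e > 0\<close> unfolding poly_approx_def
    by (meson half_gt_zero min_less_iff_conj)
  have near: "norm (p z - point_functional X z f) < e / 2"
    using p by (intro d(2)) force+
  have "norm (p z) \<le> sup_norm X p" using z p(1) by (simp add: poly_hull_def)
  also have "\<dots> \<le> sup_norm X f + e / 2"
  proof (rule sup_norm_le[OF ne])
    fix x assume "x \<in> X"
    then show "norm (p x) \<le> sup_norm X f + e / 2"
      using norm_le_sup_norm[OF X poly_approx_continuous[OF approx]] p(2)[of x]
        norm_triangle_ineq2[of "p x" "f x"] by (fastforce simp: norm_minus_commute)
  qed
  finally show "norm (point_functional X z f) \<le> sup_norm X f + e"
    using near norm_triangle_ineq2[of "point_functional X z f" "p z"]
    by (simp add: norm_minus_commute)
qed

lemma dual_norm_lower_bound: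
  assumes X: "compact X" and z: "z \<in> poly_hull X" and w: "w \<in> poly_hull X"
    and F: "poly_approx (insert z (insert w X)) F" "\<And>x. x \<in> X \<Longrightarrow> norm (F x) \<le> 1"
  shows "norm (F z - F w) \<le>
    dual_norm X (\<lambda>f. point_functional X z f - point_functional X w f)"
proof -
  have ne: "X \<noteq> {}" using poly_hull_nonempty[OF z] .
  have sub: "poly_approx (insert z X) F" "poly_approx (insert w X) F" "poly_approx X F"
    using poly_approx_subset[OF F(1)] by blast+
  have "norm (point_functional X z f - point_functional X w f) \<le> 2"
    if "f \<in> P_alg X" "sup_norm X f \<le> 1" for f
    using point_functional_norm_le[OF X z that(1)] point_functional_norm_le[OF X w that(1)] that(2)
      norm_triangle_ineq4[of "point_functional X z f" "point_functional X w f"] by simp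
  then have bdd: "bdd_above ((\<lambda>f. norm (point_functional X z f - point_functional X w f)) `
      {f \<in> P_alg X. sup_norm X f \<le> 1})"
    by (intro bdd_aboveI[of _ 2]) auto
  have "restrict F X \<in> {f \<in> P_alg X. sup_norm X f \<le> 1}"
    using sub(3) F(2) restrict_in_P_alg_iff[OF X ne] by (auto intro!: sup_norm_le ne)
  from cSUP_upper[OF this bdd] show ?thesis
    unfolding dual_norm_def
    by (simp add: point_functional_eval[OF X z sub(1)] point_functional_eval[OF X w sub(2)])
qed

text \<open>The Moebius transformation t \<mapsto> (t - r) / (1 - r t) of the disc with r = 1 - \<eta> maps
  1 - \<eta>^2 to within 2 \<eta> of 1 and every t with |t| \<le> \<eta>^2 to within 2 \<eta> of -1. Hence it
  is enough to separate the values 1 and 0, up to an error of square order, by functions in the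
  unit ball.\<close>

lemma dual_norm_ge_2I:
  assumes X: "compact X" and z: "z \<in> poly_hull X" and w: "w \<in> poly_hull X"
    and u: "\<And>\<eta>. 0 < \<eta> \<Longrightarrow> \<eta> < 1 / 2 \<Longrightarrow> \<exists>u. poly_approx (insert z (insert w X)) u \<and>
      (\<forall>x\<in>X. norm (u x) \<le> 1) \<and> u z = of_real (1 - \<eta>\<^sup>2) \<and> norm (u w) \<le> \<eta>\<^sup>2"
  shows "2 \<le> dual_norm X (\<lambda>f. point_functional X z f - point_functional X w f)"
    (is "_ \<le> ?D")
proof (rule dense_ge)
  have bound: "2 - 4 * \<eta> \<le> ?D" if \<eta>: "0 < \<eta>" "\<eta> < 1 / 2" for \<eta>
  proof -
    define Y where "Y = insert z (insert w X)"
    have Y: "compact Y" using X by (simp add: Y_def)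
    obtain u where u: "poly_approx Y u" "\<And>x. x \<in> X \<Longrightarrow> norm (u x) \<le> 1"
        "u z = of_real (1 - \<eta>\<^sup>2)" "norm (u w) \<le> \<eta>\<^sup>2"
      using u[OF \<eta>] by (auto simp: Y_def)
    define r where "r = 1 - \<eta>"
    have r: "0 < r" "r < 1" using \<eta> by (auto simp: r_def)
    have "\<eta>\<^sup>2 < 1" using \<eta> by (simp add: power_less_one_iff)
    have u1: "norm (u x) \<le> 1" if "x \<in> Y" for x
    proof -
      have "norm (u z) \<le> 1" unfolding u(3) norm_of_real using \<open>\<eta>\<^sup>2 < 1\<close> by simp
      then show ?thesis using that u(2,4) \<open>\<eta>\<^sup>2 < 1\<close> by (auto simp: Y_def)
    qed
    define F where "F x = (u x - of_real r) * (1 / (1 - of_real r * u x))" for x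
    have "poly_approx Y F"
      unfolding F_def
    proof (intro poly_approx_mult poly_approx_diff poly_approx_const u Y
        poly_approx_inverse_near_1[where r = r])
      show "norm (1 - (1 - of_real r * u x)) \<le> r" if "x \<in> Y" for x
        using u1[OF that] r by (simp add: norm_mult mult_left_le)
    qed (use r in auto)
    moreover have "norm (F x) \<le> 1" if "x \<in> X" for x
    proof -
      have "(norm (1 - of_real r * u x))\<^sup>2 - (norm (u x - of_real r))\<^sup>2 =
          (1 - r\<^sup>2) * (1 - (norm (u x))\<^sup>2)"
        unfolding cmod_power2 by (simp add: power2_eq_square algebra_simps)
      moreover have "(1 - r\<^sup>2) * (1 - (norm (u x))\<^sup>2) \<ge> 0"
        using r u(2)[OF that] by (intro mult_nonneg_nonneg) (auto simp: power_le_one)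
      ultimately have "(norm (u x - of_real r))\<^sup>2 \<le> (norm (1 - of_real r * u x))\<^sup>2"
        by linarith
      then have "norm (u x - of_real r) \<le> norm (1 - of_real r * u x)"
        by (rule power2_le_imp_le) simp
      then show ?thesis by (simp add: F_def norm_divide divide_le_eq_1)
    qed
    ultimately have D: "norm (F z - F w) \<le> ?D"
      using dual_norm_lower_bound[OF X z w] by (simp add: Y_def)
    have Fz: "norm (F z - 1) \<le> 2 * \<eta>"
    proof -
      define a where "a = 1 - \<eta>\<^sup>2"
      have "r * a \<le> r" using r \<eta> by (intro mult_left_le) (auto simp: a_def)
      then have "r * a < 1" using r(2) by linarith
      then have "F z - 1 = of_real ((a - r) / (1 - r * a) - 1)"
        unfolding F_def u(3) a_def[symmetric] by simp
      also have "norm \<dots> = \<bar>(a - r) / (1 - r * a) - 1\<bar>" by (rule norm_of_real)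
      also have "(a - r) / (1 - r * a) - 1 = - ((1 - a) * (1 + r) / (1 - r * a))"
        using \<open>r * a < 1\<close> by (simp add: field_simps)
      also have "\<bar>\<dots>\<bar> \<le> 2 * \<eta>"
      proof -
        have den: "1 - r * a \<ge> \<eta>" "1 - r * a > 0"
          using \<open>r * a < 1\<close> \<open>\<eta>\<^sup>2 < 1\<close> \<eta> unfolding a_def r_def by (simp_all add: algebra_simps)
        have "\<bar>- ((1 - a) * (1 + r) / (1 - r * a))\<bar> = \<eta>\<^sup>2 * (1 + r) / (1 - r * a)"
          using den(2) r unfolding a_def by (simp add: abs_mult)
        also have "\<dots> \<le> \<eta>\<^sup>2 * 2 / \<eta>"
          using den r \<eta> by (intro frac_le mult_mono) auto
        also have "\<dots> = 2 * \<eta>" using \<eta> by (simp add: power2_eq_square)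
        finally show ?thesis .
      qed
      finally show ?thesis .
    qed
    have Fw: "norm (F w + 1) \<le> 2 * \<eta>"
    proof -
      have uw: "norm (u w) \<le> 1 / 4"
        using u(4) power_mono[of \<eta> "1/2" 2] \<eta> by (simp add: power_divide)
      have ru: "norm (of_real r * u w) \<le> 1 / 4"
        using mult_mono[of r 1 "norm (u w)" "1/4"] uw r by (simp add: norm_mult)
      have den: "norm (1 - of_real r * u w) \<ge> 3 / 4"
        using norm_triangle_ineq2[of 1 "of_real r * u w"] ru by simp
      then have "1 - of_real r * u w \<noteq> 0" by auto
      then have "F w + 1 = of_real \<eta> * (1 + u w) / (1 - of_real r * u w)"
        unfolding F_def r_def by (simp add: field_simps)
      also have "norm \<dots> = \<eta> * norm (1 + u w) / norm (1 - of_real r * u w)"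
        using \<eta> by (simp add: norm_divide norm_mult)
      also have "\<dots> \<le> \<eta> * (5 / 4) / (3 / 4)"
        using den norm_triangle_ineq[of 1 "u w"] uw \<eta> by (intro frac_le mult_mono) auto
      also have "\<dots> \<le> 2 * \<eta>" using \<eta> by simp
      finally show ?thesis .
    qed
    have "norm ((F z - 1) - (F w + 1) + 2) \<ge> 2 - norm ((F z - 1) - (F w + 1))"
      using norm_triangle_ineq2[of 2 "- ((F z - 1) - (F w + 1))"]
      by (simp add: norm_minus_commute algebra_simps)
    moreover have "norm ((F z - 1) - (F w + 1)) \<le> 4 * \<eta>"
      using norm_triangle_ineq4[of "F z - 1" "F w + 1"] Fz Fw by simp
    ultimately show ?thesis using D by simp
  qed
  fix y :: real assume "?D < y"
  show "2 \<le> y"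
  proof (rule ccontr)
    assume "\<not> 2 \<le> y"
    define \<eta> where "\<eta> = min (1 / 4) ((2 - y) / 8)"
    have "0 < \<eta>" "\<eta> < 1 / 2" "4 * \<eta> < 2 - y"
      using \<open>\<not> 2 \<le> y\<close> by (auto simp: \<eta>_def min_def field_simps)
    then show False using bound[of \<eta>] \<open>?D < y\<close> by linarith
  qed
qed

section \<open>A dense sequence of polynomials\<close>

text \<open>Lists of terms instead of coefficient functions, so that the index type is countable.\<close>

definition rational_polynomial ::
    "(('n \<Rightarrow> nat) \<times> rat \<times> rat) list \<Rightarrow> complex ^ 'n \<Rightarrow> complex" where
  "rational_polynomial l z =
     (\<Sum>(\<alpha>, a, b)\<leftarrow>l. Complex (of_rat a) (of_rat b) * (\<Prod>i\<in>UNIV. (z $ i) ^ \<alpha> i))"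

lemma polynomial_map_monomial: "polynomial_map (\<lambda>z. c * (\<Prod>i\<in>UNIV. (z $ i) ^ \<alpha> i))"
  using polynomial_map_indexed[of "{()}" "\<lambda>_. c" "\<lambda>_. \<alpha>"] by simp

lemma polynomial_map_rational_polynomial: "polynomial_map (rational_polynomial l)"
proof (induction l)
  case Nil
  then show ?case using polynomial_map_const[of 0] by (simp add: rational_polynomial_def[abs_def])
next
  case (Cons m l)
  obtain \<alpha> a b where m: "m = (\<alpha>, a, b)" by (cases m)
  show ?case
    using polynomial_map_add[OF polynomial_map_monomial Cons, of "Complex (of_rat a) (of_rat b)" \<alpha>]
    by (simp add: rational_polynomial_def[abs_def] m)
qed

lemma gaussian_rational_dense:
  assumes "e > 0"
  obtains a b where "norm (c - Complex (of_rat a) (of_rat b)) < e"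
proof -
  obtain a where a: "\<bar>Re c - of_rat a\<bar> < e / 2"
  proof -
    obtain a where "Re c - e / 2 < of_rat a" "of_rat a < Re c"
      using of_rat_dense[of "Re c - e / 2" "Re c"] assms by auto
    then show thesis by (intro that[of a]) (simp add: abs_if)
  qed
  obtain b where b: "\<bar>Im c - of_rat b\<bar> < e / 2"
  proof -
    obtain a where "Im c - e / 2 < of_rat a" "of_rat a < Im c"
      using of_rat_dense[of "Im c - e / 2" "Im c"] assms by auto
    then show thesis by (intro that[of a]) (simp add: abs_if)
  qed
  have "norm (c - Complex (of_rat a) (of_rat b)) < e"
    using cmod_le[of "c - Complex (of_rat a) (of_rat b)"] a b by simp
  then show thesis using that by blast
qed

lemma rational_polynomial_dense:
  fixes q :: "complex ^ 'n \<Rightarrow> complex"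
  assumes "polynomial_map q" "compact K" "e > 0"
  obtains l where "\<And>z. z \<in> K \<Longrightarrow> norm (q z - rational_polynomial l z) < e"
proof -
  obtain S c where S: "finite S" "q = (\<lambda>z. \<Sum>\<alpha>\<in>S. c \<alpha> * (\<Prod>i\<in>UNIV. (z $ i) ^ \<alpha> i))"
    using assms(1) unfolding polynomial_map_def by blast
  have "\<exists>l. \<forall>z\<in>K. norm ((\<Sum>\<alpha>\<in>S. c \<alpha> * (\<Prod>i\<in>UNIV. (z $ i) ^ \<alpha> i)) - rational_polynomial l z) < e"
    using S(1) assms(3)
  proof (induction S arbitrary: e rule: finite_induct)
    case empty
    then show ?case by (intro exI[of _ "[]"]) (simp add: rational_polynomial_def)
  next
    case (insert \<alpha> S)
    define M where "M z = (\<Prod>i\<in>UNIV. (z $ i) ^ \<alpha> i)" for z :: "complex ^ 'n"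
    obtain l where l: "\<And>z. z \<in> K \<Longrightarrow>
        norm ((\<Sum>\<alpha>\<in>S. c \<alpha> * (\<Prod>i\<in>UNIV. (z $ i) ^ \<alpha> i)) - rational_polynomial l z) < e / 2"
      using insert.IH[of "e / 2"] insert.prems by auto
    have "polynomial_map M" using polynomial_map_monomial[of 1 \<alpha>] by (simp add: M_def[abs_def])
    then obtain B where B: "B > 0" "\<And>z. z \<in> K \<Longrightarrow> norm (M z) \<le> B"
      using poly_approx_bounded[OF poly_approx_polynomial assms(2)] by blast
    obtain a b where ab: "norm (c \<alpha> - Complex (of_rat a) (of_rat b)) < e / 2 / B"
      using gaussian_rational_dense[of "e / 2 / B" "c \<alpha>"] insert.prems B(1) by auto
    have "norm ((\<Sum>\<alpha>\<in>insert \<alpha> S. c \<alpha> * (\<Prod>i\<in>UNIV. (z $ i) ^ \<alpha> i)) -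
        rational_polynomial ((\<alpha>, a, b) # l) z) < e" if z: "z \<in> K" for z
    proof -
      have split: "(\<Sum>\<alpha>\<in>insert \<alpha> S. c \<alpha> * (\<Prod>i\<in>UNIV. (z $ i) ^ \<alpha> i)) -
          rational_polynomial ((\<alpha>, a, b) # l) z = (c \<alpha> - Complex (of_rat a) (of_rat b)) * M z +
          ((\<Sum>\<alpha>\<in>S. c \<alpha> * (\<Prod>i\<in>UNIV. (z $ i) ^ \<alpha> i)) - rational_polynomial l z)"
        using insert.hyps by (simp add: rational_polynomial_def M_def algebra_simps)
      have "norm ((c \<alpha> - Complex (of_rat a) (of_rat b)) * M z) \<le> e / 2 / B * B"
        unfolding norm_mult using ab B z insert.prems by (intro mult_mono) auto
      also have "\<dots> = e / 2" using B(1) by simp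
      finally show ?thesis
        unfolding split using l[OF z] norm_triangle_lt by (metis add_le_less_mono field_sum_of_halves)
    qed
    then show ?case by blast
  qed
  then show thesis using that S(2) by blast
qed

lemma dense_nonvanishing_polynomial_sequence:
  fixes x\<^sub>0 :: "complex ^ 'n"
  obtains p :: "nat \<Rightarrow> complex ^ 'n \<Rightarrow> complex" where
    "\<And>n. polynomial_map (p n)" "\<And>n. p n x\<^sub>0 \<noteq> 0"
    "\<And>q K e. polynomial_map q \<Longrightarrow> compact K \<Longrightarrow> e > 0 \<Longrightarrow> \<exists>n. \<forall>z\<in>K. norm (q z - p n z) < e"
proof -
  define p :: "nat \<Rightarrow> complex ^ 'n \<Rightarrow> complex" where
    "p n = (let r = rational_polynomial (from_nat n) in if r x\<^sub>0 = 0 then (\<lambda>_. 1) else r)" for n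
  show thesis
  proof (rule that)
    show "polynomial_map (p n)" for n
      by (simp add: p_def Let_def polynomial_map_const polynomial_map_rational_polynomial)
    show "p n x\<^sub>0 \<noteq> 0" for n by (simp add: p_def Let_def)
    fix q :: "complex ^ 'n \<Rightarrow> complex" and K :: "(complex ^ 'n) set" and e :: real
    assume q: "polynomial_map q" and K: "compact K" and e: "e > 0"
    \<comment> \<open>a small shift moves q away from the value 0 at the base point, which the sequence avoids\<close>
    define c where "c = (if q x\<^sub>0 = 0 then of_real (e / 2) else 0 :: complex)"
    have c: "q x\<^sub>0 + c \<noteq> 0" "norm c \<le> e / 2" using e by (auto simp: c_def norm_divide)
    have "polynomial_map (\<lambda>z. q z + c)" by (intro polynomial_map_add q polynomial_map_const)
    then obtain l where l: "\<And>z. z \<in> insert x\<^sub>0 K \<Longrightarrow>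
        norm (q z + c - rational_polynomial l z) < min (e / 2) (norm (q x\<^sub>0 + c))"
      using rational_polynomial_dense[of "\<lambda>z. q z + c" "insert x\<^sub>0 K" "min (e / 2) (norm (q x\<^sub>0 + c))"]
        K e c(1) by auto
    have "rational_polynomial l x\<^sub>0 \<noteq> 0" using l[of x\<^sub>0] by auto
    then have p_eq: "p (to_nat l) = rational_polynomial l" by (simp add: p_def)
    have "norm (q z - p (to_nat l) z) < e" if "z \<in> K" for z
      using l[of z] that c(2) norm_triangle_ineq4[of "q z + c - rational_polynomial l z" c]
      by (simp add: p_eq algebra_simps)
    then show "\<exists>n. \<forall>z\<in>K. norm (q z - p n z) < e" by blast
  qed
qed

section \<open>Construction of the set\<close>

text \<open>Why f n is kept in a half plane and not in a disc around 1: in dimension two, by Hurwitz's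
  theorem, a variety close to F n = 1 still meets the zero set of p n wherever F n = 1 crosses it.
  In the half plane, Re (F n) can grow towards that zero set, so that exp (m n * (F n - 1))
  compensates the small values of p n.\<close>

lemma frontier_set_with_factorizations:
  fixes \<Omega> :: "(complex ^ 'n) set" and p :: "nat \<Rightarrow> complex ^ 'n \<Rightarrow> complex"
  assumes card: "CARD('n) \<ge> 2" and \<Omega>: "open \<Omega>" "bounded \<Omega>" "x\<^sub>0 \<in> \<Omega>"
    and p: "\<And>n. polynomial_map (p n)" "\<And>n. p n x\<^sub>0 \<noteq> 0"
  obtains X f h where "compact X" "X \<subseteq> frontier \<Omega>" "x\<^sub>0 \<in> poly_hull X"
    "\<And>n. exp_polynomial (f n)" "\<And>n. exp_polynomial (h n)" "\<And>n. h n x\<^sub>0 = 0"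
    "\<And>n y. p n y = p n x\<^sub>0 * f n y * exp (h n y)" "\<And>n y. y \<in> X \<Longrightarrow> 1 / 2 \<le> Re (f n y)"
proof -
  have K: "compact (closure \<Omega>)" using \<Omega>(2) by (simp add: compact_closure)
  have ep: "exp_polynomial (p n)" for n using p(1) by (rule polynomial_map_imp_exp_polynomial)
  have "\<exists>M. 1 \<le> M \<and> (\<forall>y\<in>closure \<Omega>. norm (p n y / p n x\<^sub>0) \<le> M)" for n
  proof -
    obtain B where B: "B > 0" "\<And>y. y \<in> closure \<Omega> \<Longrightarrow> norm (p n y) \<le> B"
      using poly_approx_bounded[OF poly_approx_polynomial[OF p(1)] K] by blast
    have "norm (p n y / p n x\<^sub>0) \<le> max 1 (B / norm (p n x\<^sub>0))" if "y \<in> closure \<Omega>" for y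
      using B(2)[OF that] by (simp add: norm_divide divide_right_mono le_max_iff_disj)
    then show ?thesis by (intro exI[of _ "max 1 (B / norm (p n x\<^sub>0))"]) simp
  qed
  then obtain M where M: "\<And>n. 1 \<le> M n" "\<And>n y. y \<in> closure \<Omega> \<Longrightarrow> norm (p n y / p n x\<^sub>0) \<le> M n"
    by metis
  \<comment> \<open>Re (F n) < 1/2 gives |F (n + 1)| < M n * exp (- m n / 2) = 1/2\<close>
  define m where "m n = 2 * ln (2 * M n)" for n
  define F where "F = rec_nat (\<lambda>_. 1)
    (\<lambda>n g y. p n y / p n x\<^sub>0 * exp (of_real (m n) * (g y - 1)))"
  have F_0: "F 0 = (\<lambda>_. 1)" by (simp add: F_def)
  have F_Suc: "F (Suc n) y = p n y / p n x\<^sub>0 * exp (of_real (m n) * (F n y - 1))" for n y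
    by (simp add: F_def)
  have epF: "exp_polynomial (F n)" for n
  proof (induction n)
    case 0
    then show ?case by (simp add: F_0 exp_polynomial.const)
  next
    case (Suc n)
    have "F (Suc n) = (\<lambda>y. (1 / p n x\<^sub>0) * p n y * exp (of_real (m n) * (F n y + (- 1))))"
      by (rule ext) (simp add: F_Suc)
    then show ?case by (simp only:) (intro exp_polynomial.intros ep Suc)
  qed
  have F_x\<^sub>0: "F n x\<^sub>0 = 1" for n
    by (induction n) (simp_all add: F_0 F_Suc p(2))
  define X where "X n = {y \<in> frontier \<Omega>. 1 / 2 \<le> Re (F n y)}" for n
  have decreasing: "X (Suc n) \<subseteq> X n" for n
  proof
    fix y assume y: "y \<in> X (Suc n)"
    have m: "m n \<ge> 0" using M(1)[of n] by (simp add: m_def)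
    have "1 / 2 \<le> norm (F (Suc n) y)"
      using y complex_Re_le_cmod[of "F (Suc n) y"] by (simp add: X_def)
    also have "\<dots> = norm (p n y / p n x\<^sub>0) * exp (m n * (Re (F n y) - 1))"
      unfolding F_Suc norm_mult by simp
    also have "\<dots> \<le> M n * exp (m n * (Re (F n y) - 1))"
      using y M(2)[of y n] by (intro mult_right_mono) (auto simp: X_def frontier_def)
    finally have ge: "1 / 2 \<le> M n * exp (m n * (Re (F n y) - 1))" .
    have "1 / 2 \<le> Re (F n y)"
    proof (rule ccontr)
      assume less: "\<not> 1 / 2 \<le> Re (F n y)"
      have "m n > 0" using M(1)[of n] by (simp add: m_def)
      then have "m n * (Re (F n y) - 1) < m n * (- 1 / 2)"
        using less by (intro mult_strict_left_mono) auto
      also have "\<dots> = - ln (2 * M n)" by (simp add: m_def)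
      also have "\<dots> = ln (inverse (2 * M n))"
        by (rule ln_inverse[symmetric])
      finally have "exp (m n * (Re (F n y) - 1)) < exp (ln (inverse (2 * M n)))"
        by (rule exp_less_mono)
      also have "\<dots> = inverse (2 * M n)" using M(1)[of n] by (intro exp_ln) auto
      finally have "exp (m n * (Re (F n y) - 1)) < inverse (2 * M n)" .
      then have "M n * exp (m n * (Re (F n y) - 1)) < M n * inverse (2 * M n)"
        using M(1)[of n] by (intro mult_strict_left_mono) auto
      then show False using ge M(1)[of n] by simp
    qed
    then show "y \<in> X n" using y by (simp add: X_def)
  qed
  then have antimono: "X n \<subseteq> X m" if "m \<le> n" for m n
    using lift_Suc_antimono_le[of X] that by blast
  have compact_superlevel: "compact {y \<in> X n. c \<le> norm (g y)}" if "continuous_on UNIV g" for n c g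
  proof -
    have "continuous_on UNIV (\<lambda>y. Re (F n y))" "continuous_on UNIV (\<lambda>y. norm (g y))"
      by (intro continuous_intros exp_polynomial_continuous epF that)+
    then have "closed (frontier \<Omega> \<inter> (\<lambda>y. Re (F n y)) -` {1 / 2..} \<inter> (\<lambda>y. norm (g y)) -` {c..})"
      by (intro closed_Int closed_vimage closed_atLeast frontier_closed)
    moreover have "frontier \<Omega> \<inter> (\<lambda>y. Re (F n y)) -` {1 / 2..} \<inter> (\<lambda>y. norm (g y)) -` {c..} =
        {y \<in> X n. c \<le> norm (g y)}"
      by (auto simp: X_def)
    ultimately show ?thesis
      using bounded_subset[OF compact_imp_bounded[OF compact_frontier_bounded[OF \<Omega>(2)]]]
      by (simp add: compact_eq_bounded_closed X_def Collect_conj_eq)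
  qed
  have peak: "\<exists>y\<in>\<Inter>(range X). norm (g x\<^sub>0) \<le> norm (g y)" if "polynomial_map g" for g
  proof -
    have g: "continuous_on UNIV g" using that by (rule polynomial_map_continuous)
    have epg: "exp_polynomial g" using that by (rule polynomial_map_imp_exp_polynomial)
    have "\<Inter>(range (\<lambda>n. {y \<in> X n. norm (g x\<^sub>0) \<le> norm (g y)})) \<noteq> {}"
    proof (rule compact_nest)
      show "{y \<in> X n. norm (g x\<^sub>0) \<le> norm (g y)} \<noteq> {}" for n
      proof -
        have "1 / 2 < Re (F n x\<^sub>0)" by (simp add: F_x\<^sub>0)
        then obtain y where "y \<in> frontier \<Omega>" "1 / 2 \<le> Re (F n y)" "norm (g x\<^sub>0) \<le> norm (g y)"
          using maximum_principle_on_frontier[OF card \<Omega> epF epg] by blast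
        then show ?thesis by (auto simp: X_def)
      qed
      show "{y \<in> X n. norm (g x\<^sub>0) \<le> norm (g y)} \<subseteq> {y \<in> X m. norm (g x\<^sub>0) \<le> norm (g y)}"
        if "m \<le> n" for m n
        using antimono[OF that] by blast
    qed (rule compact_superlevel[OF g])
    then show ?thesis by auto
  qed
  define Xlim where "Xlim = \<Inter>(range X)"
  have "compact (X n)" for n
    using compact_superlevel[of "\<lambda>_. 0" n 0] by simp
  then have Xlim: "compact Xlim"
    unfolding Xlim_def by (intro compact_Inter) auto
  show thesis
  proof (rule that[of Xlim "\<lambda>n. F (Suc n)" "\<lambda>n y. of_real (m n) * ((- 1) * F n y + 1)"])
    show "x\<^sub>0 \<in> poly_hull Xlim"
      unfolding poly_hull_def
    proof (intro CollectI allI impI)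
      fix g :: "complex ^ 'n \<Rightarrow> complex" assume g: "polynomial_map g"
      then obtain y where "y \<in> Xlim" "norm (g x\<^sub>0) \<le> norm (g y)" using peak Xlim_def by blast
      then show "norm (g x\<^sub>0) \<le> sup_norm Xlim g"
        using norm_le_sup_norm[OF Xlim polynomial_map_continuous[OF g]] by force
    qed
    show "p n y = p n x\<^sub>0 * F (Suc n) y * exp (of_real (m n) * ((- 1) * F n y + 1))" for n y
    proof -
      have "exp (of_real (m n) * (F n y - 1)) * exp (of_real (m n) * ((- 1) * F n y + 1)) = 1"
        unfolding exp_add[symmetric] by (simp add: algebra_simps)
      then show ?thesis using p(2)[of n] by (simp add: F_Suc)
    qed
    show "exp_polynomial (\<lambda>y. of_real (m n) * ((- 1) * F n y + 1))" for n
      by (intro exp_polynomial.intros epF)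
    show "Xlim \<subseteq> frontier \<Omega>" by (auto simp: Xlim_def X_def)
    show "1 / 2 \<le> Re (F (Suc n) y)" if "y \<in> Xlim" for n y
      using that by (simp add: Xlim_def X_def)
  qed (simp_all add: Xlim F_x\<^sub>0 epF)
qed

section \<open>Dense invertibles and the one-point Gleason part\<close>

lemma dense_invertibles_of_factorizations:
  fixes X :: "(complex ^ 'n) set"
  assumes X: "compact X" "X \<noteq> {}"
    and p: "\<And>n. polynomial_map (p n)" "\<And>n. p n x\<^sub>0 \<noteq> 0"
    and dense: "\<And>q K e. polynomial_map q \<Longrightarrow> compact K \<Longrightarrow> e > 0 \<Longrightarrow> \<exists>n. \<forall>z\<in>K. norm (q z - p n z) < e"
    and f: "\<And>n. exp_polynomial (f n)" and h: "\<And>n. exp_polynomial (h n)"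
    and factor: "\<And>n y. p n y = p n x\<^sub>0 * f n y * exp (h n y)"
    and half: "\<And>n y. y \<in> X \<Longrightarrow> 1 / 2 \<le> Re (f n y)"
  shows "dense_invertibles X"
  unfolding dense_invertibles_def
proof (intro ballI allI impI)
  fix u and e :: real assume u: "u \<in> P_alg X" and e: "e > 0"
  have "poly_approx X u"
    using restrict_in_P_alg_iff[OF X, of u] u P_alg_restrict_eq[OF u] by simp
  then obtain q where q: "polynomial_map q" "\<And>x. x \<in> X \<Longrightarrow> norm (u x - q x) < e / 4"
    using e unfolding poly_approx_def by (metis zero_less_divide_iff zero_less_numeral)
  obtain n where n: "\<And>x. x \<in> X \<Longrightarrow> norm (q x - p n x) < e / 4"
    using dense[OF q(1) X(1), of "e / 4"] e by auto
  have in_P: "restrict (p n) X \<in> P_alg X"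
    using restrict_in_P_alg_iff[OF X] poly_approx_polynomial[OF p(1)] by blast
  define v where "v x = 1 / p n x\<^sub>0 * (1 / f n x) * exp ((- 1) * h n x)" for x
  have "poly_approx X v"
    unfolding v_def
    by (intro poly_approx_mult poly_approx_const poly_approx_exp
        poly_approx_inverse_half_plane[where c = "1 / 2"] exp_polynomial_poly_approx X(1) f h half)
      auto
  then have "restrict v X \<in> P_alg X" using restrict_in_P_alg_iff[OF X] by blast
  moreover have "restrict (p n) X x * restrict v X x = 1" if "x \<in> X" for x
  proof -
    have "f n x \<noteq> 0" using half[OF that, of n] by auto
    then show ?thesis
      using that p(2)[of n] by (simp add: v_def factor[of n x] exp_minus)
  qed
  ultimately have "restrict (p n) X \<in> P_units X" using in_P unfolding P_units_def by blast
  moreover have "sup_norm X (\<lambda>x. u x - restrict (p n) X x) \<le> e / 2"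
  proof (rule sup_norm_le[OF X(2)])
    show "norm (u x - restrict (p n) X x) \<le> e / 2" if "x \<in> X" for x
      using norm_diff_triangle_less[OF q(2)[OF that] n[OF that]] that by simp
  qed
  ultimately show "\<exists>g\<in>P_units X. sup_norm X (\<lambda>x. u x - g x) < e"
    using e by (intro bexI[of _ "restrict (p n) X"]) auto
qed

lemma point_functionals_at_distance_2:
  fixes X :: "(complex ^ 'n) set"
  assumes X: "compact X" and hull: "x\<^sub>0 \<in> poly_hull X" and w: "w \<in> poly_hull X" "w \<noteq> x\<^sub>0"
    and p: "\<And>n. polynomial_map (p n)"
    and dense: "\<And>q K e. polynomial_map q \<Longrightarrow> compact K \<Longrightarrow> e > 0 \<Longrightarrow> \<exists>n. \<forall>z\<in>K. norm (q z - p n z) < e"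
    and f: "\<And>n. exp_polynomial (f n)" and h: "\<And>n. exp_polynomial (h n)" "\<And>n. h n x\<^sub>0 = 0"
    and factor: "\<And>n y. p n y = p n x\<^sub>0 * f n y * exp (h n y)"
    and half: "\<And>n y. y \<in> X \<Longrightarrow> 1 / 2 \<le> Re (f n y)"
  shows "2 \<le> dual_norm X (\<lambda>u. point_functional X x\<^sub>0 u - point_functional X w u)"
proof (rule dual_norm_ge_2I[OF X hull w(1)])
  fix \<eta> :: real assume \<eta>: "0 < \<eta>" "\<eta> < 1 / 2"
  have "\<eta>\<^sup>2 < 1" using \<eta> by (simp add: power_less_one_iff)
  define A where "A = 1 / (1 - \<eta>\<^sup>2)"
  have A: "A > 1" using \<open>\<eta>\<^sup>2 < 1\<close> \<eta> by (simp add: A_def)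
  obtain i where i: "x\<^sub>0 $ i \<noteq> w $ i" using w(2) by (metis vec_eq_iff)
  define q where "q z = (z $ i - w $ i) * (1 / (x\<^sub>0 $ i - w $ i))" for z
  have q: "polynomial_map q" "q x\<^sub>0 = 1" "q w = 0"
  proof -
    show "polynomial_map q"
      unfolding q_def[abs_def] by (intro polynomial_map_mult polynomial_map_diff
          polynomial_map_coord polynomial_map_const)
  qed (use i in \<open>simp_all add: q_def\<close>)
  obtain B where B: "B > 0" "\<And>y. y \<in> X \<Longrightarrow> norm (q y) \<le> B"
    using poly_approx_bounded[OF poly_approx_polynomial[OF q(1)] X] by blast
  \<comment> \<open>s is fixed by the bound of q before p n is chosen, so that p n w can be small relative to s\<close>
  obtain s where s: "4 * (B + 1) < A ^ s" using real_arch_pow[OF A] by blast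
  have "s > 0" using s B(1) by (cases s) auto
  define \<delta> where "\<delta> = min (1 / 2) ((\<eta>\<^sup>2) ^ s / 4)"
  have "\<delta> > 0" using \<eta> by (simp add: \<delta>_def)
  obtain n where n: "\<And>y. y \<in> insert x\<^sub>0 (insert w X) \<Longrightarrow> norm (q y - p n y) < \<delta>"
    using dense[OF q(1), of "insert x\<^sub>0 (insert w X)" \<delta>] X \<open>\<delta> > 0\<close> by auto
  have p_x\<^sub>0: "norm (p n x\<^sub>0) \<ge> 1 / 2"
    using n[of x\<^sub>0] norm_triangle_ineq2[of "q x\<^sub>0" "p n x\<^sub>0"] by (simp add: q(2) \<delta>_def)
  define g where "g y = exp (of_real (1 / s) * h n y)" for y
  \<comment> \<open>p n x0 and f n are bounded below by 1/2, so exp (h n) is controlled by p n\<close>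
  have g_power: "norm (g y) ^ s \<le> 4 * norm (p n y)"
    if "1 / 2 \<le> Re (f n y)" for y
  proof -
    have "norm (g y) ^ s = norm (exp (of_nat s * (of_real (1 / s) * h n y)))"
      unfolding g_def exp_of_nat_mult norm_power ..
    also have "of_nat s * (of_real (1 / s) * h n y) = h n y" using \<open>s > 0\<close> by simp
    finally have "norm (p n y) = norm (p n x\<^sub>0) * norm (f n y) * norm (g y) ^ s"
      using factor[of n y] by (metis norm_mult)
    moreover have "norm (p n x\<^sub>0) * norm (f n y) \<ge> 1 / 2 * (1 / 2)"
      using p_x\<^sub>0 that complex_Re_le_cmod[of "f n y"] by (intro mult_mono) auto
    then have "norm (p n x\<^sub>0) * norm (f n y) * norm (g y) ^ s \<ge> 1 / 2 * (1 / 2) * norm (g y) ^ s"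
      by (intro mult_right_mono) auto
    ultimately show ?thesis by simp
  qed
  define u where "u y = of_real (1 - \<eta>\<^sup>2) * g y" for y
  have "poly_approx (insert x\<^sub>0 (insert w X)) u"
    unfolding u_def g_def using X
    by (intro poly_approx_mult poly_approx_const poly_approx_exp exp_polynomial_poly_approx h)
      auto
  moreover have "norm (u y) \<le> 1" if "y \<in> X" for y
  proof -
    have "norm (p n y) \<le> B + 1"
      using n[of y] B(2)[OF that] that norm_triangle_ineq2[of "p n y" "q y"]
      by (simp add: \<delta>_def norm_minus_commute)
    then have "4 * norm (p n y) \<le> 4 * (B + 1)" by simp
    with g_power[OF half[OF that]] have "norm (g y) ^ s \<le> 4 * (B + 1)" by (rule order_trans)
    also note s
    finally have "norm (g y) ^ s < A ^ s" .
    then have "norm (g y) < A"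
      by (rule power_less_imp_less_base) (use A in simp)
    then have "(1 - \<eta>\<^sup>2) * norm (g y) \<le> (1 - \<eta>\<^sup>2) * A"
      using \<open>\<eta>\<^sup>2 < 1\<close> by (intro mult_left_mono) auto
    also have "\<dots> = 1" using \<open>\<eta>\<^sup>2 < 1\<close> by (simp add: A_def)
    finally show ?thesis unfolding u_def norm_mult norm_of_real using \<open>\<eta>\<^sup>2 < 1\<close> by simp
  qed
  moreover have "u x\<^sub>0 = of_real (1 - \<eta>\<^sup>2)" by (simp add: u_def g_def h(2))
  moreover have "norm (u w) \<le> \<eta>\<^sup>2"
  proof -
    have "1 / 2 \<le> Re (f n w)"
      by (rule poly_hull_Re_ge[OF w(1) X exp_polynomial_poly_approx[OF f] half])
        (simp_all add: X)
    then have "norm (g w) ^ s \<le> 4 * norm (p n w)" by (rule g_power)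
    also have "\<dots> \<le> (\<eta>\<^sup>2) ^ s" using n[of w] by (simp add: q(3) \<delta>_def)
    finally have "norm (g w) \<le> \<eta>\<^sup>2"
      using \<open>s > 0\<close> by (metis power_mono_iff norm_ge_zero zero_le_power2)
    moreover have "norm (u w) \<le> norm (g w)"
      unfolding u_def norm_mult norm_of_real using \<open>\<eta>\<^sup>2 < 1\<close>
      by (intro mult_left_le_one_le) auto
    ultimately show ?thesis by simp
  qed
  ultimately show "\<exists>u. poly_approx (insert x\<^sub>0 (insert w X)) u \<and> (\<forall>x\<in>X. norm (u x) \<le> 1) \<and>
      u x\<^sub>0 = of_real (1 - \<eta>\<^sup>2) \<and> norm (u w) \<le> \<eta>\<^sup>2"
    by blast
qed

theorem mainTheorem3:
  fixes \<Omega> :: "(complex ^ 'n) set" and x\<^sub>0 :: "complex ^ 'n"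
  assumes "CARD('n) \<ge> 2"
    and "open \<Omega>" and "bounded \<Omega>" and "x\<^sub>0 \<in> \<Omega>"
  shows "\<exists>X. compact X \<and> X \<subseteq> frontier \<Omega> \<and>
           x\<^sub>0 \<in> poly_hull X - X \<and> {x\<^sub>0} \<in> gleason_parts X \<and> dense_invertibles X"
proof -
  obtain p :: "nat \<Rightarrow> complex ^ 'n \<Rightarrow> complex" where
    p: "\<And>n. polynomial_map (p n)" "\<And>n. p n x\<^sub>0 \<noteq> 0" and
    dense: "\<And>q K e. polynomial_map q \<Longrightarrow> compact K \<Longrightarrow> e > 0 \<Longrightarrow> \<exists>n. \<forall>z\<in>K. norm (q z - p n z) < e"
    by (rule dense_nonvanishing_polynomial_sequence[of x\<^sub>0]) (rule that)
  obtain X f h where X: "compact X" "X \<subseteq> frontier \<Omega>" and hull: "x\<^sub>0 \<in> poly_hull X"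
    and f: "\<And>n. exp_polynomial (f n)" and h: "\<And>n. exp_polynomial (h n)" "\<And>n. h n x\<^sub>0 = 0"
    and factor: "\<And>n y. p n y = p n x\<^sub>0 * f n y * exp (h n y)"
    and half: "\<And>n y. y \<in> X \<Longrightarrow> 1 / 2 \<le> Re (f n y)"
    by (rule frontier_set_with_factorizations[OF assms p]) (rule that)
  have ne: "X \<noteq> {}" using poly_hull_nonempty[OF hull] .
  have "x\<^sub>0 \<notin> X" using X(2) assms(2,4) by (auto simp: frontier_def interior_open)
  moreover have "dense_invertibles X"
    by (rule dense_invertibles_of_factorizations[OF X(1) ne p dense f h(1) factor half])
  moreover have "{x\<^sub>0} \<in> gleason_parts X"
  proof -
    have far: "2 \<le> dual_norm X (\<lambda>u. point_functional X x\<^sub>0 u - point_functional X w u)"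
      if "w \<in> poly_hull X" "w \<noteq> x\<^sub>0" for w
      by (rule point_functionals_at_distance_2[OF X(1) hull that p(1) dense f h factor half])
    have "dual_norm X (\<lambda>u. point_functional X x\<^sub>0 u - point_functional X x\<^sub>0 u) < 2"
    proof -
      have "restrict (\<lambda>_. 0) X \<in> {u \<in> P_alg X. sup_norm X u \<le> 1}"
        using restrict_in_P_alg_iff[OF X(1) ne] by (auto intro!: sup_norm_le ne poly_approx_const)
      then have "{u \<in> P_alg X. sup_norm X u \<le> 1} \<noteq> {}" by blast
      then show ?thesis by (simp add: dual_norm_def)
    qed
    then have "gleason_rel X `` {x\<^sub>0} = {x\<^sub>0}"
      using hull far by (force simp: gleason_rel_def)
    then show ?thesis using quotientI[OF hull, of "gleason_rel X"] by (simp add: gleason_parts_def)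
  qed
  ultimately show ?thesis using X hull by blast
qed

end
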